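(* Let the game, the sets $X_i$, $\Theta$, the functions $f_i$, the communication graph, the function $\hat{\mathbf F}$, and the constants $L_F$, $\xi>0$ be as in the context, with Assumptions 1, 2 and 3 listed there. Let $\alpha_0>0$. For each integer $K\ge1$ let $\{\theta_k\}_{k=0}^{K-1}$ be generated by the exact zeroth-order algorithm described in the context with constant stepsize $\alpha=\frac{\alpha_0}{\sqrt K}$. Then, over those $K$ for which $\alpha\le\frac{\xi}{2(nNL_F+1)}$, $$\frac1K\sum_{k=0}^{K-1}\mathrm E\big[\|\nabla\hat{\mathbf F}(\theta_k)\|^2\big]=\mathcal O\Big(\frac1{\sqrt K}\Big),$$ i.e. there is a constant $C>0$ independent of $K$ such that the left-hand side is at most $CK^{-1/2}$.
   Context: **Game.** There are $N$ players. Player $i\in[N]:=\{1,\dots,N\}$ chooses $x_i\in X_i\subseteq\mathbb R^{d_i}$; $d=\sum_i d_i$, $X=X_1\times\cdots\times X_N\subseteq\mathbb R^d$, $x=(x_i)_{i\in[N]}$, $x_{-i}=(x_j)_{j\ne i}$. Given a regulator decision $\theta\in\mathbb R^n$, player $i$ has real-valued cost $f_i(x_i,x_{-i},\theta)=f_i(x,\theta)$. A point $x(\theta)\in X$ is a Nash equilibrium (NE) for $\theta$ if $f_i(x_i(\theta),x_{-i}(\theta),\theta)\le f_i(x_i,x_{-i}(\theta),\theta)$ for all $x_i\in X_i$, $i\in[N]$. The pseudo-gradient is $G(x,\theta)=(\nabla_{x_i}f_i(x_i,x_{-i},\theta))_{i\in[N]}\in\mathbb R^d$. The regulator's feasible set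 is $\Theta\subseteq\mathbb R^n$. Norms are Euclidean. **Assumption 1.** (i) Each $X_i$ is nonempty, compact, convex. (ii) $\Theta$ is nonempty, closed, convex. (iii) For each $i$, $f_i(x_i,x_{-i},\theta)$ is continuously differentiable and convex in $x_i$ for any $x_{-i}\in\mathbb R^{d-d_i}$, $\theta\in\mathbb R^n$. (iv) There is $L_\theta>0$ with $|f_i(x,\theta)-f_i(x,\theta')|\le L_\theta\|\theta-\theta'\|$ for all $i$, $x\in X$, $\theta,\theta'\in\mathbb R^n$. Moreover there is a constant $L_x>0$ with $|f_i(x,\theta)-f_i(x',\theta)|\le L_x\|x-x'\|$ for all $i$, $x,x'\in X$, $\theta\in\mathbb R^n$. **Assumption 2.** (i) There are $\mu,l>0$ such that for all $\theta\in\mathbb R^n$, $x,x'\in\mathbb R^d$: $(G(x,\theta)-G(x',\theta))^\top(x-x')\ge\mu\|x-x'\|^2$ and $\|G(x,\theta)-G(x',\theta)\|\le l\|x-x'\|$. (ii) There is $l_\theta>0$ with $\|G(x,\theta)-G(x,\theta')\|\le l_\theta\|\theta-\theta'\|$ for all $x\in X$, $\theta,\theta'\in\mathbb R^n$. Under these assumptions the NE $x(\theta)$ exists and is unique for every $\theta\in\mathbb R^n$. **Assumption 3.** The players communicate over a strongly connected directed graph on $[N]$ with doubly stochastic adjacency matrix $\mathcal A=[a_{ij}]$, where $a_{ij}>0$ if $(j,i)$ is an edge or $i=j$, and $a_{ij}=0$ otherwise. (The graph plays no role in the exact algorithm.) **Objectives.** $F_i(\theta):=f_i(x(\theta),\theta)$,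 $F:=\sum_{i=1}^NF_i$. $L_F>0$ is a constant with $|F_i(\theta)-F_i(\theta')|\le L_F\|\theta-\theta'\|$ for all $i\in[N]$, $\theta,\theta'\in\mathbb R^n$. For a fixed smoothing parameter $\xi>0$: $\hat F(\theta):=\sum_{i=1}^N\mathrm E_\nu[F_i(\theta+\xi\nu)]$ with $\nu$ uniform on the closed unit ball of $\mathbb R^n$; $\hat\chi_\Theta(\theta):=\frac1{2\xi}\mathrm{dist}^2(\theta,\Theta)$, so $\nabla\hat\chi_\Theta(\theta)=\frac1\xi(\theta-\Pi_\Theta(\theta))$ with $\Pi_\Theta$ the Euclidean projection; $\hat{\mathbf F}:=\hat F+\hat\chi_\Theta$, whose minimum $\hat{\mathbf F}^*$ over $\mathbb R^n$ is assumed to exist. **Exact algorithm.** Start from a deterministic $\theta_0\in\Theta$ (not depending on $K$). For $k=0,1,\dots,K-1$: draw $u_k$ uniformly from the unit sphere of $\mathbb R^n$, independently of the past; set $$\hat\nabla F(\theta_k)=\sum_{i=1}^N\frac n\xi\big(f_i(x(\theta_k+\xi u_k),\theta_k+\xi u_k)-f_i(x(\theta_k),\theta_k)\big)u_k,$$ $$\theta_{k+1}=\theta_k-\alpha\Big(\hat\nabla F(\theta_k)+\frac1\xi(\theta_k-\Pi_\Theta(\theta_k))\Big).$$ *)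

theory Defs
  imports "HOL-Probability.Probability"
begin

section \<open>Games with block-structured strategies\<close>

text \<open>
  The players are the elements of a finite type \<open>'p\<close>, so \<open>N = CARD('p)\<close>.  The block dimensions
  \<open>d\<^sub>i\<close> depend on the player, so they cannot be types.  Joint strategies are therefore vectors in
  \<open>real ^ 'd\<close> with \<open>d = CARD('d)\<close>, and \<open>own j\<close> is the player to whom coordinate \<open>j\<close> belongs.  Player
  \<open>i\<close> controls the \<open>d\<^sub>i\<close> coordinates \<open>{j. own j = i}\<close>, and her space of strategies (of dimension
  \<open>d\<^sub>i\<close>) is the coordinate subspace of vectors vanishing outside these coordinates.
\<close>

definition player_space :: "('d \<Rightarrow> 'p) \<Rightarrow> 'p \<Rightarrow> (real ^ 'd) set" where
  "player_space own i = {y. \<forall>j. own j \<noteq> i \<longrightarrow> y $ j = 0}"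

definition block :: "('d \<Rightarrow> 'p) \<Rightarrow> 'p \<Rightarrow> real ^ 'd \<Rightarrow> real ^ 'd" where
  "block own i x = (\<chi> j. if own j = i then x $ j else 0)"

text \<open>\<open>deviate own i y x\<close> is the joint strategy \<open>(y, x\<^bsub>-i\<^esub>)\<close>.\<close>

definition deviate :: "('d \<Rightarrow> 'p) \<Rightarrow> 'p \<Rightarrow> real ^ 'd \<Rightarrow> real ^ 'd \<Rightarrow> real ^ 'd" where
  "deviate own i y x = (\<chi> j. if own j = i then y $ j else x $ j)"

definition joint_strategies ::
    "('d \<Rightarrow> 'p) \<Rightarrow> ('p \<Rightarrow> (real ^ 'd) set) \<Rightarrow> (real ^ 'd) set" where
  "joint_strategies own X = {x. \<forall>i. block own i x \<in> X i}"

definition nash_equilibrium ::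
    "('d \<Rightarrow> 'p) \<Rightarrow> ('p \<Rightarrow> (real ^ 'd) set) \<Rightarrow> ('p \<Rightarrow> real ^ 'd \<Rightarrow> real ^ 'n \<Rightarrow> real) \<Rightarrow>
     real ^ 'n \<Rightarrow> real ^ 'd \<Rightarrow> bool" where
  "nash_equilibrium own X f \<theta> x \<longleftrightarrow>
     x \<in> joint_strategies own X \<and> (\<forall>i. \<forall>y\<in>X i. f i x \<theta> \<le> f i (deviate own i y x) \<theta>)"

definition nash ::
    "('d \<Rightarrow> 'p) \<Rightarrow> ('p \<Rightarrow> (real ^ 'd) set) \<Rightarrow> ('p \<Rightarrow> real ^ 'd \<Rightarrow> real ^ 'n \<Rightarrow> real) \<Rightarrow>
     real ^ 'n \<Rightarrow> real ^ 'd" where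
  "nash own X f \<theta> = (THE x. nash_equilibrium own X f \<theta> x)"

definition gradient :: "('a::real_inner \<Rightarrow> real) \<Rightarrow> 'a \<Rightarrow> 'a" where
  "gradient h x = (THE D. GDERIV h x :> D)"

text \<open>
  The function \<open>\<lambda>y. f i (deviate own i y x) \<theta>\<close> only depends on block \<open>i\<close> of \<open>y\<close>.  Hence it is
  differentiable on \<open>real ^ 'd\<close> iff \<open>f\<^sub>i\<close> is differentiable in \<open>x\<^sub>i\<close>, and its gradient is the partial
  gradient with respect to \<open>x\<^sub>i\<close>, padded with zeros outside block \<open>i\<close>.  The same applies to convexity.
\<close>

definition pseudo_gradient ::
    "('d::finite \<Rightarrow> 'p) \<Rightarrow> ('p \<Rightarrow> real ^ 'd \<Rightarrow> real ^ 'n \<Rightarrow> real) \<Rightarrow>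
     real ^ 'd \<Rightarrow> real ^ 'n \<Rightarrow> real ^ 'd" where
  "pseudo_gradient own f x \<theta> =
     (\<chi> j. gradient (\<lambda>y. f (own j) (deviate own (own j) y x) \<theta>) x $ j)"

definition continuously_differentiable :: "('a::real_inner \<Rightarrow> real) \<Rightarrow> bool" where
  "continuously_differentiable h \<longleftrightarrow> (\<exists>g. (\<forall>y. GDERIV h y :> g y) \<and> continuous_on UNIV g)"


section \<open>Standing assumptions\<close>

definition regular_game ::
    "('d::finite \<Rightarrow> 'p::finite) \<Rightarrow> ('p \<Rightarrow> (real ^ 'd) set) \<Rightarrow>
     ('p \<Rightarrow> real ^ 'd \<Rightarrow> real ^ 'n \<Rightarrow> real) \<Rightarrow> (real ^ 'n::finite) set \<Rightarrow> bool" where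
  "regular_game own X f \<Theta> \<longleftrightarrow>
     (\<forall>i. X i \<subseteq> player_space own i \<and> X i \<noteq> {} \<and> compact (X i) \<and> convex (X i)) \<and>
     (\<Theta> \<noteq> {} \<and> closed \<Theta> \<and> convex \<Theta>) \<and>
     (\<forall>i x \<theta>. continuously_differentiable (\<lambda>y. f i (deviate own i y x) \<theta>) \<and>
              convex_on UNIV (\<lambda>y. f i (deviate own i y x) \<theta>)) \<and>
     (\<exists>L\<^sub>\<theta>>0. \<forall>i. \<forall>x\<in>joint_strategies own X. \<forall>\<theta> \<theta>'.
        \<bar>f i x \<theta> - f i x \<theta>'\<bar> \<le> L\<^sub>\<theta> * norm (\<theta> - \<theta>')) \<and>
     (\<exists>L\<^sub>x>0. \<forall>i. \<forall>x\<in>joint_strategies own X. \<forall>x'\<in>joint_strategies own X. \<forall>\<theta>.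
        \<bar>f i x \<theta> - f i x' \<theta>\<bar> \<le> L\<^sub>x * norm (x - x'))"

definition regular_pseudo_gradient ::
    "('d::finite \<Rightarrow> 'p::finite) \<Rightarrow> ('p \<Rightarrow> (real ^ 'd) set) \<Rightarrow>
     ('p \<Rightarrow> real ^ 'd \<Rightarrow> real ^ 'n::finite \<Rightarrow> real) \<Rightarrow> bool" where
  "regular_pseudo_gradient own X f \<longleftrightarrow>
     (\<exists>\<mu>>0. \<exists>l>0. \<forall>\<theta> x x'.
        (pseudo_gradient own f x \<theta> - pseudo_gradient own f x' \<theta>) \<bullet> (x - x') \<ge> \<mu> * (norm (x - x'))\<^sup>2 \<and>
        norm (pseudo_gradient own f x \<theta> - pseudo_gradient own f x' \<theta>) \<le> l * norm (x - x')) \<and>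
     (\<exists>l\<^sub>\<theta>>0. \<forall>x\<in>joint_strategies own X. \<forall>\<theta> \<theta>'.
        norm (pseudo_gradient own f x \<theta> - pseudo_gradient own f x \<theta>') \<le> l\<^sub>\<theta> * norm (\<theta> - \<theta>'))"

definition doubly_stochastic :: "real ^ 'p ^ 'p::finite \<Rightarrow> bool" where
  "doubly_stochastic A \<longleftrightarrow>
     (\<forall>i j. A $ i $ j \<ge> 0) \<and> (\<forall>i. (\<Sum>j\<in>UNIV. A $ i $ j) = 1) \<and> (\<forall>j. (\<Sum>i\<in>UNIV. A $ i $ j) = 1)"

text \<open>The pair \<open>(j, i) \<in> E\<close> is an edge from \<open>j\<close> to \<open>i\<close>.\<close>

definition communication_graph :: "('p \<times> 'p) set \<Rightarrow> real ^ 'p ^ 'p::finite \<Rightarrow> bool" where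
  "communication_graph E A \<longleftrightarrow>
     (\<forall>i j. (i, j) \<in> E\<^sup>*) \<and> doubly_stochastic A \<and>
     (\<forall>i j. if (j, i) \<in> E \<or> i = j then A $ i $ j > 0 else A $ i $ j = 0)"


section \<open>Objectives\<close>

definition objective ::
    "('d \<Rightarrow> 'p) \<Rightarrow> ('p \<Rightarrow> (real ^ 'd) set) \<Rightarrow> ('p \<Rightarrow> real ^ 'd \<Rightarrow> real ^ 'n \<Rightarrow> real) \<Rightarrow>
     'p \<Rightarrow> real ^ 'n \<Rightarrow> real" where
  "objective own X f i \<theta> = f i (nash own X f \<theta>) \<theta>"

definition uniform_ball :: "'a::euclidean_space measure" where
  "uniform_ball = uniform_measure lborel (cball 0 1)"

definition smoothed_objective ::
    "('d \<Rightarrow> 'p::finite) \<Rightarrow> ('p \<Rightarrow> (real ^ 'd) set) \<Rightarrow>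
     ('p \<Rightarrow> real ^ 'd \<Rightarrow> real ^ 'n::finite \<Rightarrow> real) \<Rightarrow> real \<Rightarrow> real ^ 'n \<Rightarrow> real" where
  "smoothed_objective own X f \<xi> \<theta> =
     (\<Sum>i\<in>UNIV. \<integral>\<nu>. objective own X f i (\<theta> + \<xi> *\<^sub>R \<nu>) \<partial>uniform_ball)"

definition penalized_objective ::
    "('d \<Rightarrow> 'p::finite) \<Rightarrow> ('p \<Rightarrow> (real ^ 'd) set) \<Rightarrow>
     ('p \<Rightarrow> real ^ 'd \<Rightarrow> real ^ 'n::finite \<Rightarrow> real) \<Rightarrow> (real ^ 'n) set \<Rightarrow> real \<Rightarrow> real ^ 'n \<Rightarrow> real" where
  "penalized_objective own X f \<Theta> \<xi> \<theta> =
     smoothed_objective own X f \<xi> \<theta> + 1 / (2 * \<xi>) * (infdist \<theta> \<Theta>)\<^sup>2"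


section \<open>The exact zeroth-order algorithm\<close>

text \<open>
  The normalized surface measure of the unit sphere: the measure of a set of directions is the
  normalized volume of the part of the unit ball that lies in these directions, i.e. the image of
  the uniform distribution on the ball under \<open>x \<mapsto> x / \<parallel>x\<parallel>\<close> (the origin is a null set).
\<close>

definition uniform_sphere :: "'a::euclidean_space measure" where
  "uniform_sphere = distr uniform_ball borel sgn"

definition gradient_estimate ::
    "('d \<Rightarrow> 'p::finite) \<Rightarrow> ('p \<Rightarrow> (real ^ 'd) set) \<Rightarrow>
     ('p \<Rightarrow> real ^ 'd \<Rightarrow> real ^ 'n::finite \<Rightarrow> real) \<Rightarrow> real \<Rightarrow> real ^ 'n \<Rightarrow> real ^ 'n \<Rightarrow> real ^ 'n" where
  "gradient_estimate own X f \<xi> \<theta> u =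
     (\<Sum>i\<in>UNIV. (real CARD('n) / \<xi> *
        (f i (nash own X f (\<theta> + \<xi> *\<^sub>R u)) (\<theta> + \<xi> *\<^sub>R u) - f i (nash own X f \<theta>) \<theta>)) *\<^sub>R u)"

primrec zo_iterate ::
    "('d \<Rightarrow> 'p::finite) \<Rightarrow> ('p \<Rightarrow> (real ^ 'd) set) \<Rightarrow>
     ('p \<Rightarrow> real ^ 'd \<Rightarrow> real ^ 'n::finite \<Rightarrow> real) \<Rightarrow> (real ^ 'n) set \<Rightarrow>
     real \<Rightarrow> real \<Rightarrow> real ^ 'n \<Rightarrow> (nat \<Rightarrow> real ^ 'n) \<Rightarrow> nat \<Rightarrow> real ^ 'n" where
  "zo_iterate own X f \<Theta> \<xi> \<alpha> \<theta>\<^sub>0 u 0 = \<theta>\<^sub>0"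
| "zo_iterate own X f \<Theta> \<xi> \<alpha> \<theta>\<^sub>0 u (Suc k) =
     (let \<theta> = zo_iterate own X f \<Theta> \<xi> \<alpha> \<theta>\<^sub>0 u k
      in \<theta> - \<alpha> *\<^sub>R (gradient_estimate own X f \<xi> \<theta> (u k) + (1 / \<xi>) *\<^sub>R (\<theta> - closest_point \<Theta> \<theta>)))"


subsection \<open>Sanity checks for the uniform distribution on the sphere\<close>

lemma prob_space_uniform_ball: "prob_space (uniform_ball :: 'a::euclidean_space measure)"
  unfolding uniform_ball_def
proof (rule prob_space_uniform_measure)
  have "0 < emeasure lborel (ball (0::'a) 1)"
    by (simp add: emeasure_ball)
  also have "\<dots> \<le> emeasure lborel (cball (0::'a) 1)"
    by (rule emeasure_mono) auto
  finally show "emeasure lborel (cball (0::'a) 1) \<noteq> 0" by simp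
qed (use emeasure_lborel_cball_finite in \<open>auto simp: less_top\<close>)

lemma measurable_sgn [measurable]: "(sgn :: 'a::euclidean_space \<Rightarrow> 'a) \<in> borel_measurable borel"
  unfolding sgn_div_norm by measurable

lemma prob_space_uniform_sphere: "prob_space (uniform_sphere :: 'a::euclidean_space measure)"
  unfolding uniform_sphere_def
  by (intro prob_space.prob_space_distr prob_space_uniform_ball)
     (simp add: uniform_ball_def uniform_measure_def)

lemma AE_uniform_sphere: "AE u in uniform_sphere. norm (u :: 'a::euclidean_space) = 1"
proof -
  have "AE x in lborel. x \<noteq> (0::'a)"
    by (rule AE_lborel_singleton)
  then have "AE x in uniform_ball. norm (sgn (x::'a)) = 1"
    unfolding uniform_ball_def by (intro AE_uniform_measureI) (auto simp: norm_sgn)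
  then show ?thesis
    unfolding uniform_sphere_def
    by (subst AE_distr_iff) (auto simp: uniform_ball_def)
qed

lemma lborel_orthogonal:
  fixes T :: "real ^ 'n::{finite,wellorder} \<Rightarrow> real ^ 'n::{finite,wellorder}"
  assumes T: "orthogonal_transformation T"
  shows "distr lborel borel T = lborel"
proof (rule lborel_eqI[symmetric])
  have [measurable]: "T \<in> borel_measurable borel"
    using T by (intro borel_measurable_continuous_onI linear_continuous_on)
      (simp add: linear_linear orthogonal_transformation_linear)
  fix l u :: "real ^ 'n::{finite,wellorder}"
  assume le: "\<And>b. b \<in> Basis \<Longrightarrow> l \<bullet> b \<le> u \<bullet> b"
  have "bij T" using T by (rule orthogonal_transformation_bij)
  then have pre: "T -` box l u = inv T ` box l u"
    by (simp add: bij_vimage_eq_inv_image)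
  have oi: "orthogonal_transformation (inv T)"
    using T by (rule orthogonal_transformation_inv)
  have b: "bounded (inv T ` box l u)"
    using oi by (intro bounded_linear_image) (auto simp: linear_linear orthogonal_transformation_linear)
  have m: "T -` box l u \<in> sets borel" by (rule measurable_sets_borel[of T borel]) auto
  have "emeasure (distr lborel borel T) (box l u) = emeasure lborel (T -` box l u)"
    by (simp add: emeasure_distr)
  also have "\<dots> = ennreal (measure lborel (T -` box l u))"
    using b emeasure_bounded_finite[OF b] by (intro emeasure_eq_ennreal_measure) (auto simp: pre)
  also have "measure lborel (T -` box l u) = measure lebesgue (inv T ` box l u)"
    using m by (simp add: pre)
  also have "\<dots> = measure lborel (box l u)"
    by (subst measure_orthogonal_image[OF oi]) auto
  also have "ennreal (measure lborel (box l u)) = (\<Prod>b\<in>Basis. (u - l) \<bullet> b)"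
    using le by (simp add: measure_lborel_box_eq)
  finally show "emeasure (distr lborel borel T) (box l u) = (\<Prod>b\<in>Basis. (u - l) \<bullet> b)" .
qed simp

lemma uniform_sphere_orthogonal_invariant:
  fixes T :: "real ^ 'n::{finite,wellorder} \<Rightarrow> real ^ 'n::{finite,wellorder}"
  assumes T: "orthogonal_transformation T"
  shows "distr uniform_sphere borel T = uniform_sphere"
proof -
  have [measurable]: "T \<in> borel_measurable borel"
    using T by (intro borel_measurable_continuous_onI linear_continuous_on)
      (simp add: linear_linear orthogonal_transformation_linear)
  have nT: "norm (T x) = norm x" for x using T by (rule orthogonal_transformation_norm)
  have sg: "T \<circ> sgn = sgn \<circ> T"
    using orthogonal_transformation_linear[OF T]
    by (auto simp: fun_eq_iff sgn_div_norm linear_scale nT)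
  have ball: "distr uniform_ball borel T = uniform_ball"
  proof (rule measure_eqI)
    fix A assume "A \<in> sets (distr uniform_ball borel T)"
    then have A [measurable]: "A \<in> sets borel" by simp
    have "T -` (cball 0 1 \<inter> A) = cball 0 1 \<inter> T -` A"
      by (auto simp: nT)
    moreover have "emeasure lborel (cball 0 1 \<inter> A) = emeasure (distr lborel borel T) (cball 0 1 \<inter> A)"
      by (simp add: lborel_orthogonal[OF T])
    ultimately have *: "emeasure lborel (cball 0 1 \<inter> T -` A) = emeasure lborel (cball 0 1 \<inter> A)"
      by (simp add: emeasure_distr)
    have "T -` A \<in> sets borel"
      by (rule measurable_sets_borel[of T borel]) auto
    then show "emeasure (distr uniform_ball borel T) A = emeasure uniform_ball A"
      by (subst emeasure_distr) (auto simp: uniform_ball_def * )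
  qed (simp add: uniform_ball_def)
  have [measurable]: "sgn \<in> uniform_ball \<rightarrow>\<^sub>M (borel :: (real ^ 'n::{finite,wellorder}) measure)"
       "T \<in> uniform_ball \<rightarrow>\<^sub>M borel"
    by (simp_all add: uniform_ball_def)
  have "distr uniform_sphere borel T = distr uniform_ball borel (sgn \<circ> T)"
    unfolding uniform_sphere_def by (subst distr_distr) (simp_all add: sg)
  also have "\<dots> = distr (distr uniform_ball borel T) borel sgn"
    by (subst distr_distr) simp_all
  finally show ?thesis by (simp add: ball uniform_sphere_def)
qed

end

theory Submission
  imports Defs
begin

text \<open>
  The ball average \<open>J(\<theta>) = E[h(\<theta> + \<xi>\<nu>)]\<close> of a Lipschitz function \<open>h\<close> has gradient
  \<open>(n/\<xi>) E[h(\<theta> + \<xi>u) u]\<close> with \<open>u\<close> uniform on the sphere.  As \<open>h\<close> need not be differentiable, the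
  derivative has to fall on the kernel.  The kernels \<open>(r\<^sup>2 - \<parallel>x\<parallel>\<^sup>2)\<^sup>+ / 2\<close> have gradient \<open>-x\<close> on the ball
  of radius \<open>r\<close>, and the difference of those for radii \<open>1\<close> and \<open>r\<close>, divided by \<open>(1 - r\<^sup>2) / 2\<close>, tends to the
  indicator of the unit ball as \<open>r \<rightarrow> 1\<close>, while its gradient concentrates on a thin shell.  There \<open>h\<close> may
  be replaced by its value at the radial projection, and the integral of a function of \<open>x / \<parallel>x\<parallel>\<close> over a shell
  follows from scaling.

  Consequently the two-point estimate is unbiased with bounded noise, the smoothed objective has an
  \<open>nNL\<^sub>F / \<xi>\<close>-Lipschitz gradient, and the penalty satisfies the descent inequality with constant \<open>1 / \<xi>\<close>.
  Summing the expected descent over \<open>K\<close> steps of size \<open>\<alpha>\<close> bounds the mean squared gradient by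
  \<open>O(1 / (\<alpha>K) + \<alpha>)\<close>.
\<close>

section \<open>Averages over balls\<close>

lemma set_integrable_lborel_bounded:
  fixes g :: "'a::euclidean_space \<Rightarrow> 'b::{banach, second_countable_topology}"
  assumes "S \<in> sets borel" "bounded S" "g \<in> borel_measurable borel" "\<And>x. x \<in> S \<Longrightarrow> norm (g x) \<le> C"
  shows "set_integrable lborel S g"
  unfolding set_integrable_def
  by (rule integrableI_bounded_set_indicator[where B = C])
     (use assms emeasure_bounded_finite[of S] in auto)

lemma norm_set_integral_lborel_le:
  fixes g :: "'a::euclidean_space \<Rightarrow> 'b::{banach, second_countable_topology}"
  assumes "S \<in> sets borel" "bounded S" "g \<in> borel_measurable borel" "\<And>x. x \<in> S \<Longrightarrow> norm (g x) \<le> C"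
  shows "norm (LINT x:S|lborel. g x) \<le> C * measure lborel S"
proof -
  have "set_integrable lborel S g"
    by (rule set_integrable_lborel_bounded[OF assms])
  moreover have "set_integrable lborel S (\<lambda>_. C)"
    by (rule set_integrable_lborel_bounded[OF assms(1,2), where C = "\<bar>C\<bar>"]) auto
  ultimately have "norm (LINT x:S|lborel. g x) \<le> (LINT x:S|lborel. C)"
    unfolding set_integrable_def set_lebesgue_integral_def
    by (intro Bochner_Integration.integral_norm_bound_integral) (auto simp: indicator_def assms(4))
  also have "\<dots> = C * measure lborel S"
    using assms(1,2) emeasure_bounded_finite[of S]
    by (simp add: set_integral_const)
  finally show ?thesis .
qed

lemma measure_spherical_shell:
  fixes a b :: real
  assumes "0 \<le> a" "a \<le> b"
  shows "measure lborel (cball 0 b - cball (0::'a::euclidean_space) a) =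
    unit_ball_vol (real DIM('a)) * (b ^ DIM('a) - a ^ DIM('a))"
proof -
  have "measure lborel (cball 0 b - cball (0::'a) a) =
      measure lborel (cball (0::'a) b) - measure lborel (cball (0::'a) a)"
    using assms emeasure_lborel_cball_finite[of "0::'a" b]
    by (intro measure_Diff) auto
  then show ?thesis
    using assms by (simp add: content_cball algebra_simps)
qed

text \<open>The substitution \<open>x = r y\<close> has Jacobian \<open>r ^ DIM('a)\<close> and
  leaves \<open>sgn\<close> unchanged, because \<open>r\<close> is positive. This evaluates shell
  integrals of functions of the direction alone.\<close>

lemma set_integral_cball_sgn:
  fixes H :: "'a::euclidean_space \<Rightarrow> 'b::{banach, second_countable_topology}"
  assumes H: "H \<in> borel_measurable borel" and r: "0 < r"
  shows "(LINT x:cball 0 r|lborel. H (sgn x)) = r ^ DIM('a) *\<^sub>R (LINT x:cball 0 1|lborel. H (sgn x))"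
proof -
  have meas: "(\<lambda>x::'a. indicator (cball 0 r) x *\<^sub>R H (sgn x)) \<in> borel_measurable borel"
    by (intro borel_measurable_scaleR borel_measurable_indicator measurable_compose[OF measurable_sgn H]) auto
  have "(LINT x:cball 0 r|lborel. H (sgn x)) =
      (LINT x|density (distr lborel borel (\<lambda>x. 0 + r *\<^sub>R x)) (\<lambda>_. \<bar>r\<bar> ^ DIM('a)).
         indicator (cball 0 r) (x::'a) *\<^sub>R H (sgn x))"
    unfolding set_lebesgue_integral_def using r
    by (subst lborel_affine[of r "0::'a", symmetric]) auto
  also have "\<dots> = (LINT x|distr lborel borel (\<lambda>x. 0 + r *\<^sub>R x).
      \<bar>r\<bar> ^ DIM('a) *\<^sub>R (indicator (cball 0 r) (x::'a) *\<^sub>R H (sgn x)))"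
    using meas by (subst integral_density) auto
  also have "\<dots> = (LINT x|lborel.
      \<bar>r\<bar> ^ DIM('a) *\<^sub>R (indicator (cball 0 r) (r *\<^sub>R x::'a) *\<^sub>R H (sgn (r *\<^sub>R x))))"
    using meas by (subst integral_distr) (auto simp del: scaleR_scaleR)
  also have "\<dots> = (LINT x|lborel. r ^ DIM('a) *\<^sub>R (indicator (cball 0 1) x *\<^sub>R H (sgn x)))"
    using r by (intro Bochner_Integration.integral_cong) (auto simp: indicator_def sgn_scaleR)
  also have "\<dots> = r ^ DIM('a) *\<^sub>R (LINT x:cball 0 1|lborel. H (sgn x))"
    unfolding set_lebesgue_integral_def by (rule integral_scaleR_right)
  finally show ?thesis .
qed

section \<open>Differentiating averages against truncated paraboloids\<close>

text \<open>A shift by \<open>w\<close> changes the kernel by \<open>w \<bullet> x\<close> on the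
  ball, up to an error of order \<open>(norm w)\<^sup>2\<close>. The kink at radius \<open>r\<close>
  adds an error of order \<open>norm w\<close>, but only on a shell whose volume can be made
  arbitrarily small. Continuity of \<open>h\<close> therefore suffices.\<close>

lemma GDERIV_paraboloid_average:
  fixes h :: "'a::euclidean_space \<Rightarrow> real"
  assumes h: "continuous_on UNIV h" and r: "0 < r"
  shows "GDERIV (\<lambda>t. \<integral>x. max 0 ((r\<^sup>2 - (norm x)\<^sup>2) / 2) * h (t + x) \<partial>lborel) \<theta> :>
    (LINT x:cball 0 r|lborel. h (\<theta> + x) *\<^sub>R x)"
proof -
  define k where "k x = h (\<theta> + x)" for x
  have k: "continuous_on UNIV k"
    unfolding k_def by (intro continuous_on_compose2[OF h] continuous_intros) auto
  then have [measurable]: "k \<in> borel_measurable borel"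
    by (rule borel_measurable_continuous_onI)
  define p where "p x = max 0 ((r\<^sup>2 - (norm x)\<^sup>2) / 2)" for x :: 'a
  have [measurable]: "p \<in> borel_measurable borel" unfolding p_def by measurable
  define D where "D = (LINT x:cball 0 r|lborel. k x *\<^sub>R x)"
  define V where "V = unit_ball_vol (real DIM('a))"
  \<comment> \<open>For \<open>norm w \<le> 1\<close> this ball contains the support of every
    shifted kernel, so one bound \<open>K\<close> on \<open>k\<close> serves all shifts.\<close>
  define B where "B = cball (0::'a) (r + 1)"
  have B [measurable]: "B \<in> sets borel" "bounded B" unfolding B_def by auto
  obtain K where K: "\<And>x. x \<in> B \<Longrightarrow> \<bar>k x\<bar> \<le> K" "K > 0"
  proof -
    have "bounded (k ` B)"
      by (intro compact_imp_bounded compact_continuous_image continuous_on_subset[OF k]) (auto simp: B_def)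
    then show ?thesis using that unfolding bounded_pos by (metis imageI real_norm_def)
  qed
  \<comment> \<open>On \<open>B\<close>, with \<open>norm w \<le> 1\<close>, a shift by
    \<open>w\<close> changes the paraboloid before truncation by at most
    \<open>c * norm w\<close>.\<close>
  define c where "c = r + 2"
  \<comment> \<open>Translation invariance of Lebesgue measure moves the increment from
    \<open>h\<close> to the kernel.\<close>
  have shift: "(\<integral>x. p x * h ((\<theta> + w) + x) \<partial>lborel) = (\<integral>x. p (x - w) * k x \<partial>lborel)" for w
  proof -
    have "(\<integral>x. p (x - w) * k x \<partial>lborel) = (\<integral>x. p (x - w) * k x \<partial>distr lborel borel ((+) w))"
      by (simp add: lborel_distr_plus)
    also have "\<dots> = (\<integral>x. p x * h ((\<theta> + w) + x) \<partial>lborel)"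
      by (subst integral_distr) (measurable, simp add: k_def ac_simps)
    finally show ?thesis ..
  qed
  have outside: "p (x - w) = 0" if "norm w \<le> 1" "x \<notin> B" for x w
  proof -
    have "norm x - norm w \<le> norm (x - w)" by (rule norm_triangle_ineq2)
    with that have "r \<le> norm (x - w)" by (auto simp: B_def)
    with r have "r\<^sup>2 \<le> (norm (x - w))\<^sup>2" by (intro power_mono) auto
    then show ?thesis by (simp add: p_def)
  qed
  have int: "integrable lborel (\<lambda>x. p (x - w) * k x)" if "norm w \<le> 1" for w
  proof -
    have "p y \<le> r\<^sup>2" "0 \<le> p y" for y by (auto simp: p_def field_simps)
    then have "set_integrable lborel B (\<lambda>x. p (x - w) * k x)"
      using B K by (intro set_integrable_lborel_bounded[where C = "r\<^sup>2 * K"])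
        (auto simp: abs_mult intro!: mult_mono)
    moreover have "(\<lambda>x. indicator B x *\<^sub>R (p (x - w) * k x)) = (\<lambda>x. p (x - w) * k x)"
      using outside[OF that] by (force simp: indicator_def)
    ultimately show ?thesis by (simp add: set_integrable_def)
  qed
  have sub: "cball 0 r \<subseteq> B" by (auto simp: B_def)
  have intD: "integrable lborel (\<lambda>x. indicator (cball 0 r) x *\<^sub>R (k x *\<^sub>R x))"
    unfolding set_integrable_def[symmetric]
    using sub K by (intro set_integrable_lborel_bounded[where C = "K * r"])
      (auto intro!: mult_mono)
  have bound: "norm ((\<integral>x. p x * h (\<theta> + w + x) \<partial>lborel) - (\<integral>x. p x * h (\<theta> + x) \<partial>lborel) - w \<bullet> D)
     \<le> K * V * r ^ DIM('a) * (norm w)\<^sup>2 / 2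
        + K * c * V * ((r + \<eta>) ^ DIM('a) - (r - \<eta>) ^ DIM('a)) * norm w"
    if w: "norm w \<le> 1" and \<eta>: "0 < \<eta>" "\<eta> < r" "\<eta> < 1" "c * norm w < \<eta> * r / 2" for w \<eta>
  proof -
    define Z where "Z = cball (0::'a) (r + \<eta>) - cball 0 (r - \<eta>)"
    have Z: "Z \<in> sets borel" "bounded Z" "Z \<subseteq> B" unfolding Z_def B_def using \<eta> by auto
    define R where "R x = p (x - w) - p x - indicator (cball 0 r) x * (w \<bullet> x)" for x
    \<comment> \<open>Here \<open>s\<close> is the paraboloid before truncation and \<open>t\<close>
      its change. Where \<open>\<bar>s\<bar> > c * norm w\<close>, the truncation acts alike on
      \<open>s\<close> and \<open>s + t\<close>, so that only the quadratic term remains on the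
      ball, and nothing outside it.\<close>
    have R: "\<bar>R x\<bar> \<le> indicator (cball 0 r) x * ((norm w)\<^sup>2 / 2) + indicator Z x * (c * norm w)"
      if x: "x \<in> B" for x
    proof -
      define s where "s = (r\<^sup>2 - (norm x)\<^sup>2) / 2"
      define t where "t = w \<bullet> x - (norm w)\<^sup>2 / 2"
      have pst: "p (x - w) = max 0 (s + t)" "p x = max 0 s"
        by (auto simp: p_def s_def t_def power2_norm_eq_inner algebra_simps inner_commute
              add_divide_distrib diff_divide_distrib)
      have ball: "x \<in> cball 0 r \<longleftrightarrow> s \<ge> 0"
        using r abs_le_square_iff[of "norm x" r] by (auto simp: s_def)
      have t: "\<bar>t\<bar> \<le> c * norm w"
      proof -
        have "\<bar>w \<bullet> x\<bar> \<le> norm w * (r + 1)"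
          using x Cauchy_Schwarz_ineq2[of w x] mult_left_mono[of "norm x" "r + 1" "norm w"]
          by (auto simp: B_def)
        moreover have "(norm w)\<^sup>2 \<le> norm w * 1"
          unfolding power2_eq_square using w by (intro mult_left_mono) auto
        moreover have "\<bar>t\<bar> \<le> \<bar>w \<bullet> x\<bar> + (norm w)\<^sup>2 / 2"
          unfolding t_def using abs_triangle_ineq4[of "w \<bullet> x" "(norm w)\<^sup>2 / 2"] by simp
        ultimately have "\<bar>t\<bar> \<le> norm w * (r + 1) + norm w" using norm_ge_zero[of w] by linarith
        then show ?thesis by (simp add: c_def algebra_simps)
      qed
      \<comment> \<open>The assumption \<open>c * norm w < \<eta> * r / 2\<close> makes
        \<open>s\<close> so small that \<open>norm x\<close> lies within \<eta> of
        \<open>r\<close>.\<close>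
      have "x \<in> Z" if "\<bar>s\<bar> \<le> c * norm w"
      proof -
        have s: "\<bar>s\<bar> < \<eta> * r / 2" using that \<eta> by linarith
        have "\<not> norm x > r + \<eta>"
        proof
          assume "norm x > r + \<eta>"
          then have "(r + \<eta>)\<^sup>2 \<le> (norm x)\<^sup>2" using r \<eta> by (intro power_mono) auto
          moreover have "(r + \<eta>)\<^sup>2 = r\<^sup>2 + 2 * (\<eta> * r) + \<eta>\<^sup>2" by (simp add: power2_eq_square algebra_simps)
          moreover have "\<eta> * r > 0" using r \<eta> by simp
          ultimately have "2 * (\<eta> * r) \<le> (norm x)\<^sup>2 - r\<^sup>2" using zero_le_power2[of \<eta>] by linarith
          then have "s \<le> - (\<eta> * r)" unfolding s_def by simp
          then show False using s \<open>\<eta> * r > 0\<close> by linarith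
        qed
        moreover have "\<not> norm x \<le> r - \<eta>"
        proof
          assume "norm x \<le> r - \<eta>"
          then have "(norm x)\<^sup>2 \<le> (r - \<eta>)\<^sup>2" using r \<eta> by (intro power_mono) auto
          moreover have "(r - \<eta>)\<^sup>2 = r\<^sup>2 - 2 * (\<eta> * r) + \<eta> * \<eta>" by (simp add: power2_eq_square algebra_simps)
          moreover have "\<eta> * \<eta> \<le> \<eta> * r" using r \<eta> by (intro mult_left_mono) auto
          ultimately have "s \<ge> \<eta> * r / 2" unfolding s_def by simp
          then show False using s by linarith
        qed
        ultimately show ?thesis by (auto simp: Z_def)
      qed
      moreover define q where "q = (norm w)\<^sup>2 / 2"
      moreover have "q \<ge> 0" "w \<bullet> x = t + q" by (simp_all add: q_def t_def)
      ultimately show ?thesis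
        using ball t unfolding R_def pst q_def[symmetric]
        by (cases "x \<in> Z"; cases "x \<in> cball 0 r") (auto simp: max_def split: if_splits)
    qed
    have "(\<integral>x. p x * h (\<theta> + w + x) \<partial>lborel) - (\<integral>x. p x * h (\<theta> + x) \<partial>lborel) - w \<bullet> D
        = (\<integral>x. p (x - w) * k x \<partial>lborel) - (\<integral>x. p (x - 0) * k x \<partial>lborel)
          - (\<integral>x. w \<bullet> (indicator (cball 0 r) x *\<^sub>R (k x *\<^sub>R x)) \<partial>lborel)"
      unfolding shift[symmetric] using integral_inner_right[OF intD, of w]
      by (simp add: D_def set_lebesgue_integral_def)
    also have "\<dots> = (\<integral>x. p (x - w) * k x - p (x - 0) * k x
        - w \<bullet> (indicator (cball 0 r) x *\<^sub>R (k x *\<^sub>R x)) \<partial>lborel)"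
      using int[OF w] int[of 0] intD
      by (subst Bochner_Integration.integral_diff | intro Bochner_Integration.integrable_diff
            integrable_inner_right | simp)+
    also have "\<dots> = (\<integral>x. R x * k x \<partial>lborel)"
      by (intro Bochner_Integration.integral_cong) (auto simp: R_def algebra_simps)
    finally have eq: "(\<integral>x. p x * h (\<theta> + w + x) \<partial>lborel) - (\<integral>x. p x * h (\<theta> + x) \<partial>lborel) - w \<bullet> D
        = (\<integral>x. R x * k x \<partial>lborel)" .
    have iR: "integrable lborel (\<lambda>x. R x * k x)"
    proof -
      have "integrable lborel (\<lambda>x. p (x - w) * k x - p (x - 0) * k x
        - w \<bullet> (indicator (cball 0 r) x *\<^sub>R (k x *\<^sub>R x)))"
        using int[OF w] int[of 0] intD by (intro Bochner_Integration.integrable_diff integrable_inner_right) auto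
      then show ?thesis by (simp add: R_def algebra_simps)
    qed
    have i1: "set_integrable lborel (cball 0 r) (\<lambda>_::'a. K * ((norm w)\<^sup>2 / 2))"
      by (intro set_integrable_lborel_bounded[where C = "\<bar>K * ((norm w)\<^sup>2 / 2)\<bar>"]) auto
    have i2: "set_integrable lborel Z (\<lambda>_::'a. K * (c * norm w))"
      using Z by (intro set_integrable_lborel_bounded[where C = "\<bar>K * (c * norm w)\<bar>"]) auto
    have "norm (\<integral>x. R x * k x \<partial>lborel) \<le>
       (\<integral>x. indicator (cball 0 r) x *\<^sub>R (K * ((norm w)\<^sup>2 / 2)) + indicator Z x *\<^sub>R (K * (c * norm w)) \<partial>lborel)"
    proof (rule Bochner_Integration.integral_norm_bound_integral[OF iR])
      show "integrable lborel (\<lambda>x. indicator (cball 0 r) x *\<^sub>R (K * ((norm w)\<^sup>2 / 2)) + indicator Z x *\<^sub>R (K * (c * norm w)))"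
        using i1 i2 by (auto simp: set_integrable_def)
      fix x :: 'a
      show "norm (R x * k x) \<le> indicator (cball 0 r) x *\<^sub>R (K * ((norm w)\<^sup>2 / 2)) + indicator Z x *\<^sub>R (K * (c * norm w))"
      proof (cases "x \<in> B")
        case True
        have "\<bar>R x\<bar> * \<bar>k x\<bar> \<le> (indicator (cball 0 r) x * ((norm w)\<^sup>2 / 2) + indicator Z x * (c * norm w)) * K"
          using R[OF True] K(1)[OF True] K(2) by (intro mult_mono) auto
        then show ?thesis by (simp add: abs_mult algebra_simps)
      next
        case False
        then have "x \<notin> cball 0 r" using sub by blast
        then have "R x = 0" using outside[OF w False] outside[of 0 x] False by (simp add: R_def)
        then show ?thesis using K(2) r by (auto simp: indicator_def c_def)
      qed
    qed
    also have "\<dots> = K * ((norm w)\<^sup>2 / 2) * measure lborel (cball (0::'a) r) + K * (c * norm w) * measure lborel Z"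
      using i1 i2 Z emeasure_bounded_finite[OF Z(2)] emeasure_lborel_cball_finite[of "0::'a" r]
      unfolding set_integrable_def
      by (subst Bochner_Integration.integral_add)
         (auto simp: set_lebesgue_integral_def[symmetric] set_integral_const)
    also have "\<dots> = K * V * r ^ DIM('a) * (norm w)\<^sup>2 / 2
        + K * c * V * ((r + \<eta>) ^ DIM('a) - (r - \<eta>) ^ DIM('a)) * norm w"
      using \<eta> r unfolding Z_def
      by (subst measure_spherical_shell) (auto simp: V_def content_cball algebra_simps)
    finally show ?thesis unfolding eq .
  qed
  show ?thesis
    unfolding gderiv_def has_derivative_at_alt
  proof (intro conjI allI impI)
    show "bounded_linear (\<lambda>w. w \<bullet> (LINT x:cball 0 r|lborel. h (\<theta> + x) *\<^sub>R x))"
      by (rule bounded_linear_inner_left)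
    fix e :: real assume e: "e > 0"
    \<comment> \<open>The shell width \<eta> is fixed first, depending only on \<open>e\<close>, so
      that the shell contributes at most half of the error. The neighbourhood of \<theta> is chosen
      afterwards.\<close>
    have "((\<lambda>\<eta>. K * c * V * ((r + \<eta>) ^ DIM('a) - (r - \<eta>) ^ DIM('a))) \<longlongrightarrow>
        K * c * V * ((r + 0) ^ DIM('a) - (r - 0) ^ DIM('a))) (at_right 0)"
      by (intro tendsto_intros)
    then have "eventually (\<lambda>\<eta>. K * c * V * ((r + \<eta>) ^ DIM('a) - (r - \<eta>) ^ DIM('a)) < e / 2) (at_right 0)"
      by (rule order_tendstoD) (use e in auto)
    moreover have "eventually (\<lambda>\<eta>. \<eta> < min r 1) (at_right 0)" "eventually (\<lambda>\<eta>. 0 < \<eta>) (at_right (0::real))"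
      using r eventually_at_right_real[of 0 "min r 1"] by (auto elim: eventually_mono)
    ultimately have "eventually (\<lambda>\<eta>. K * c * V * ((r + \<eta>) ^ DIM('a) - (r - \<eta>) ^ DIM('a)) < e / 2 \<and>
      \<eta> < min r 1 \<and> 0 < \<eta>) (at_right 0)" by eventually_elim auto
    then obtain \<eta> where \<eta>: "K * c * V * ((r + \<eta>) ^ DIM('a) - (r - \<eta>) ^ DIM('a)) < e / 2"
        "\<eta> < r" "\<eta> < 1" "0 < \<eta>"
      using eventually_happens[of _ "at_right (0::real)"] by (auto simp: trivial_limit_at_right_real)
    define Q where "Q = K * V * r ^ DIM('a)"
    have Q: "Q > 0" using K r by (auto simp: Q_def V_def)
    \<comment> \<open>The three entries give \<open>norm w \<le> 1\<close>, a quadratic term of at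
      most \<open>e / 2 * norm w\<close>, and the smallness condition tied to \<eta>.\<close>
    define d where "d = Min {1, e / Q, \<eta> * r / 2 / c}"
    have c: "c > 0" using r by (simp add: c_def)
    have d: "d > 0" using e Q \<eta> r c by (auto simp: d_def)
    have "norm ((\<integral>x. p x * h (y + x) \<partial>lborel) - (\<integral>x. p x * h (\<theta> + x) \<partial>lborel) - (y - \<theta>) \<bullet> D)
        \<le> e * norm (y - \<theta>)" if y: "norm (y - \<theta>) < d" for y
    proof -
      define w where "w = y - \<theta>"
      have w: "norm w < 1" "norm w < e / Q" "norm w < \<eta> * r / 2 / c"
        using y by (auto simp: d_def w_def)
      have "norm ((\<integral>x. p x * h (\<theta> + w + x) \<partial>lborel) - (\<integral>x. p x * h (\<theta> + x) \<partial>lborel) - w \<bullet> D)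
          \<le> Q * (norm w)\<^sup>2 / 2 + K * c * V * ((r + \<eta>) ^ DIM('a) - (r - \<eta>) ^ DIM('a)) * norm w"
        unfolding Q_def using \<eta> w c by (intro bound) (auto simp: field_simps)
      also have "\<dots> \<le> e / 2 * norm w + e / 2 * norm w"
      proof (intro add_mono mult_right_mono)
        have "Q * norm w \<le> e" using w Q by (simp add: field_simps)
        then have "Q * norm w * norm w \<le> e * norm w" by (intro mult_right_mono) auto
        then show "Q * (norm w)\<^sup>2 / 2 \<le> e / 2 * norm w" by (simp add: power2_eq_square)
      qed (use \<eta> in auto)
      finally show ?thesis by (simp add: w_def)
    qed
    then show "\<exists>d>0. \<forall>y. norm (y - \<theta>) < d \<longrightarrow>
      norm ((\<integral>x. max 0 ((r\<^sup>2 - (norm x)\<^sup>2) / 2) * h (y + x) \<partial>lborel)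
        - (\<integral>x. max 0 ((r\<^sup>2 - (norm x)\<^sup>2) / 2) * h (\<theta> + x) \<partial>lborel)
        - (y - \<theta>) \<bullet> (LINT x:cball 0 r|lborel. h (\<theta> + x) *\<^sub>R x)) \<le> e * norm (y - \<theta>)"
      using d unfolding p_def D_def k_def by blast
  qed
qed

section \<open>From paraboloid kernels to the indicator of the ball\<close>

lemma set_integral_lborel_Diff:
  fixes g :: "'a::euclidean_space \<Rightarrow> 'b::{banach, second_countable_topology}"
  assumes "set_integrable lborel S g" "set_integrable lborel T g" "T \<subseteq> S"
  shows "(LINT x:S - T|lborel. g x) = (LINT x:S|lborel. g x) - (LINT x:T|lborel. g x)"
proof -
  have "(\<lambda>x. indicator (S - T) x *\<^sub>R g x) = (\<lambda>x. indicator S x *\<^sub>R g x - indicator T x *\<^sub>R g x)"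
    using assms(3) by (auto simp: fun_eq_iff indicator_def)
  then show ?thesis
    using assms(1,2) by (simp add: set_lebesgue_integral_def set_integrable_def)
qed

text \<open>No sign of \<open>L\<close> is presupposed: a negative \<open>L\<close> forces
  \<open>h\<close> to be constant.\<close>

lemma lipschitz_imp_continuous_UNIV:
  fixes h :: "'a::real_normed_vector \<Rightarrow> 'b::real_normed_vector"
  assumes "\<And>x y. norm (h x - h y) \<le> L * norm (x - y)"
  shows "continuous_on UNIV h"
proof -
  have "L-lipschitz_on UNIV h" if "L \<ge> 0"
    using assms that by (auto simp: lipschitz_on_def dist_norm)
  moreover have "h x = h y" if "L < 0" for x y
    using assms[of x y] that by (smt (verit) mult_nonpos_nonneg norm_ge_zero norm_le_zero_iff right_minus_eq)
  then have "h = (\<lambda>_. h 0)" if "L < 0" using that by blast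
  ultimately show ?thesis
    by (metis continuous_on_const linorder_not_le lipschitz_on_continuous_on)
qed

text \<open>For each \<open>r < 1\<close> the scaled difference of two paraboloid averages is
  differentiable at \<theta>. As \<open>r\<close> tends to 1, its gradient tends to the claimed
  vector, and its difference from the ball average becomes Lipschitz around \<theta> with a
  vanishing constant. Together these bounds pass differentiability on to the limit.\<close>

lemma GDERIV_set_integral_cball:
  fixes h :: "'a::euclidean_space \<Rightarrow> real"
  assumes lip: "\<And>x y. \<bar>h x - h y\<bar> \<le> L * norm (x - y)"
  shows "GDERIV (\<lambda>t. LINT x:cball 0 1|lborel. h (t + x)) \<theta> :>
    real DIM('a) *\<^sub>R (LINT x:cball 0 1|lborel. h (\<theta> + sgn x) *\<^sub>R sgn x)"
proof -
  have h: "continuous_on UNIV h"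
    using lip by (intro lipschitz_imp_continuous_UNIV[where L = L]) auto
  have [measurable]: "h \<in> borel_measurable borel"
    using h by (rule borel_measurable_continuous_onI)
  have L: "L \<ge> 0"
  proof -
    obtain b :: 'a where "b \<in> Basis" using nonempty_Basis by blast
    then show ?thesis using order_trans[OF abs_ge_zero lip[of b 0]] by simp
  qed
  define n where "n = DIM('a)"
  define V where "V = unit_ball_vol (real DIM('a))"
  define J where "J t = (LINT x:cball 0 1|lborel. h (t + x))" for t
  define H where "H x = h (\<theta> + x) *\<^sub>R x" for x
  have [measurable]: "H \<in> borel_measurable borel" unfolding H_def by measurable
  have [measurable]: "(\<lambda>x. H (sgn x)) \<in> borel_measurable borel"
    by (rule measurable_compose[OF measurable_sgn]) measurable
  define Q where "Q = (LINT x:cball 0 1|lborel. H (sgn x))"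
  define a where "a r x = max 0 ((r\<^sup>2 - (norm x)\<^sup>2) / 2)" for r and x :: 'a
  have [measurable]: "a r \<in> borel_measurable borel" for r unfolding a_def by measurable
  define A where "A r t = (\<integral>x. a r x * h (t + x) \<partial>lborel)" for r t
  define G where "G r = (LINT x:cball 0 r|lborel. H x)" for r
  have A: "GDERIV (A r) \<theta> :> G r" if "0 < r" for r
    using GDERIV_paraboloid_average[OF h that, of \<theta>] by (simp add: A_def[abs_def] a_def G_def H_def)
  have bdd: "\<exists>C. \<forall>x\<in>cball 0 1. \<bar>h (t + x)\<bar> \<le> C" for t
  proof -
    have "bounded ((\<lambda>x. h (t + x)) ` cball 0 1)"
      by (intro compact_imp_bounded compact_continuous_image
            continuous_on_compose2[OF h] continuous_intros) auto
    then show ?thesis unfolding bounded_iff by auto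
  qed
  obtain K where K: "\<And>x. x \<in> cball 0 1 \<Longrightarrow> \<bar>h (\<theta> + x)\<bar> \<le> K" using bdd by blast
  have K0: "K \<ge> 0" using K[of 0] by (smt (verit) abs_ge_zero centre_in_cball)
  have aint: "integrable lborel (\<lambda>x. a r x * h (t + x))" if r: "0 < r" "r \<le> 1" for r t
  proof -
    obtain C where C: "\<And>x. x \<in> cball 0 1 \<Longrightarrow> \<bar>h (t + x)\<bar> \<le> C" using bdd by blast
    have "a r x \<le> r\<^sup>2" "0 \<le> a r x" for x by (auto simp: a_def field_simps)
    then have "set_integrable lborel (cball 0 1) (\<lambda>x. a r x * h (t + x))"
      using C by (intro set_integrable_lborel_bounded[where C = "r\<^sup>2 * C"])
        (auto simp: abs_mult intro!: mult_mono)
    moreover have "a r x = 0" if "x \<notin> cball 0 1" for x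
    proof -
      have "r\<^sup>2 \<le> (norm x)\<^sup>2" using that r by (intro power_mono) auto
      then show ?thesis by (simp add: a_def)
    qed
    then have "(\<lambda>x. indicator (cball 0 1) x *\<^sub>R (a r x * h (t + x))) = (\<lambda>x. a r x * h (t + x))"
      by (force simp: indicator_def)
    ultimately show ?thesis by (simp add: set_integrable_def)
  qed
  have Jint: "integrable lborel (\<lambda>x. indicator (cball 0 1) x * h (t + x))" for t
  proof -
    obtain C where C: "\<And>x. x \<in> cball 0 1 \<Longrightarrow> \<bar>h (t + x)\<bar> \<le> C" using bdd by blast
    then have "set_integrable lborel (cball 0 1) (\<lambda>x. h (t + x))"
      by (intro set_integrable_lborel_bounded[where C = C]) auto
    then show ?thesis by (simp add: set_integrable_def)
  qed
  define S where "S r = cball (0::'a) 1 - cball 0 r" for r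
  have S [measurable]: "S r \<in> sets borel" "bounded (S r)" for r
    by (auto simp: S_def bounded_subset[OF bounded_cball Diff_subset])
  have mS: "measure lborel (S r) = V * (1 - r ^ n)" if "0 < r" "r < 1" for r
    unfolding S_def using that by (subst measure_spherical_shell) (auto simp: V_def n_def)
  \<comment> \<open>\<open>c r * (a 1 x - a r x)\<close> is 1 for \<open>\<parallel>x\<parallel> \<le> r\<close>, 0 for \<open>\<parallel>x\<parallel> \<ge> 1\<close> and between 0 and 1 otherwise.\<close>
  define c where "c r = 2 / (1 - r\<^sup>2)" for r :: real
  have c: "c r > 0" if "0 < r" "r < 1" for r
  proof -
    have "r\<^sup>2 < 1" using that by (simp add: power_less_one_iff)
    then show ?thesis by (simp add: c_def)
  qed
  \<comment> \<open>The factor \<open>1 - r\<close>, supplied by the thickness of the shell, cancels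
    the singularity of \<open>c r\<close> at \<open>r = 1\<close>.\<close>
  have cr: "c r * (1 - r) = 2 / (1 + r)" if "0 < r" "r < 1" for r
  proof -
    have "1 - r\<^sup>2 = (1 - r) * (1 + r)" by (simp add: power2_eq_square algebra_simps)
    then show ?thesis using that by (simp add: c_def divide_simps)
  qed
  \<comment> \<open>The first term comes from replacing the geometric sum by its limit
    \<open>n\<close>, the second from projecting the shell radially onto the sphere. Both vanish as
    \<open>r\<close> tends to 1.\<close>
  define \<beta> where "\<beta> r = \<bar>2 / (1 + r) * (\<Sum>i<n. r ^ i) - n\<bar> * norm Q
     + 2 / (1 + r) * ((L + K) * (V * (1 - r ^ n)))" for r
  have gradient_close: "norm (c r *\<^sub>R (G 1 - G r) - real n *\<^sub>R Q) \<le> \<beta> r" if r: "0 < r" "r < 1" for r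
  proof -
    have nH: "norm (H x) \<le> K" if "x \<in> cball 0 1" for x
    proof -
      have "\<bar>h (\<theta> + x)\<bar> * norm x \<le> K * 1" using K[OF that] K0 that by (intro mult_mono) auto
      then show ?thesis by (simp add: H_def)
    qed
    have ints: "set_integrable lborel T H" "set_integrable lborel T (\<lambda>x. H (sgn x))"
      if "T \<subseteq> cball 0 1" "T \<in> sets borel" for T
      using that bounded_subset[OF bounded_cball that(1)]
      by (auto intro!: set_integrable_lborel_bounded[where C = K] nH simp: norm_sgn)
    have "G 1 - G r = (LINT x:S r|lborel. H x)"
      unfolding G_def S_def using r by (intro set_integral_lborel_Diff[symmetric] ints) auto
    \<comment> \<open>After radial projection the integrand depends on the direction only, so
      scaling gives the exact shell integral.\<close>
    moreover have "(1 - r ^ n) *\<^sub>R Q = (LINT x:S r|lborel. H (sgn x))"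
    proof -
      have "(LINT x:S r|lborel. H (sgn x)) = Q - (LINT x:cball 0 r|lborel. H (sgn x))"
        unfolding Q_def S_def using r by (intro set_integral_lborel_Diff ints) auto
      also have "(LINT x:cball 0 r|lborel. H (sgn x)) = r ^ n *\<^sub>R Q"
        unfolding Q_def n_def using r by (intro set_integral_cball_sgn) auto
      finally show ?thesis by (simp add: algebra_simps)
    qed
    ultimately have "(G 1 - G r) - (1 - r ^ n) *\<^sub>R Q = (LINT x:S r|lborel. H x - H (sgn x))"
      using ints[of "S r"] by (auto simp: set_integral_diff S_def)
    also have "norm \<dots> \<le> ((L + K) * (1 - r)) * measure lborel (S r)"
    proof (intro norm_set_integral_lborel_le S)
      fix x assume x: "x \<in> S r"
      then have nx: "r < norm x" "norm x \<le> 1" by (auto simp: S_def)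
      then have "x \<noteq> 0" using r by auto
      have "x - sgn x = (norm x - 1) *\<^sub>R sgn x"
        using \<open>x \<noteq> 0\<close> by (simp add: sgn_div_norm algebra_simps)
      then have d: "norm (x - sgn x) \<le> 1 - r"
        using nx \<open>x \<noteq> 0\<close> by (simp add: norm_sgn)
      \<comment> \<open>The first summand is controlled by the Lipschitz bound on \<open>h\<close>,
        the second by the bound \<open>K\<close> on the sphere. Each carries a factor
        \<open>1 - r\<close>.\<close>
      have "H x - H (sgn x) = (h (\<theta> + x) - h (\<theta> + sgn x)) *\<^sub>R x + h (\<theta> + sgn x) *\<^sub>R (x - sgn x)"
        by (simp add: H_def algebra_simps)
      also have "norm \<dots> \<le> \<bar>h (\<theta> + x) - h (\<theta> + sgn x)\<bar> * norm x + \<bar>h (\<theta> + sgn x)\<bar> * norm (x - sgn x)"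
        by (rule order_trans[OF norm_triangle_ineq]) simp
      also have "\<dots> \<le> L * (1 - r) * 1 + K * (1 - r)"
      proof (intro add_mono mult_mono)
        show "\<bar>h (\<theta> + x) - h (\<theta> + sgn x)\<bar> \<le> L * (1 - r)"
          using lip[of "\<theta> + x" "\<theta> + sgn x"] mult_left_mono[OF d L] by simp
        show "\<bar>h (\<theta> + sgn x)\<bar> \<le> K" by (rule K) (simp add: norm_sgn)
      qed (use nx d r L K0 in auto)
      finally show "norm (H x - H (sgn x)) \<le> (L + K) * (1 - r)" by (simp add: algebra_simps)
    qed measurable
    finally have err: "norm ((G 1 - G r) - (1 - r ^ n) *\<^sub>R Q) \<le> (1 - r) * ((L + K) * (V * (1 - r ^ n)))"
      using mS[OF r] by (simp add: algebra_simps)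
    have geo: "c r * (1 - r ^ n) = 2 / (1 + r) * (\<Sum>i<n. r ^ i)"
      using cr[OF r] by (simp add: one_diff_power_eq mult.assoc[symmetric])
    have "c r *\<^sub>R (G 1 - G r) - real n *\<^sub>R Q
        = (c r * (1 - r ^ n) - n) *\<^sub>R Q + c r *\<^sub>R ((G 1 - G r) - (1 - r ^ n) *\<^sub>R Q)"
      by (simp add: algebra_simps)
    also have "norm \<dots> \<le> \<bar>c r * (1 - r ^ n) - n\<bar> * norm Q + c r * norm ((G 1 - G r) - (1 - r ^ n) *\<^sub>R Q)"
      using c[OF r] by (intro order_trans[OF norm_triangle_ineq]) simp
    also have "\<dots> \<le> \<bar>c r * (1 - r ^ n) - n\<bar> * norm Q
        + c r * ((1 - r) * ((L + K) * (V * (1 - r ^ n))))"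
      using err c[OF r] by (intro add_mono mult_left_mono) auto
    also have "\<dots> = \<beta> r" unfolding \<beta>_def geo mult.assoc[symmetric] cr[OF r] ..
    finally show ?thesis .
  qed
  have increment_close: "\<bar>(J y - c r * (A 1 y - A r y)) - (J \<theta> - c r * (A 1 \<theta> - A r \<theta>))\<bar>
      \<le> L * (V * (1 - r ^ n)) * norm (y - \<theta>)" if r: "0 < r" "r < 1" for r y
  proof -
    \<comment> \<open>This is the part of the ball indicator missed by the kernels. Since it lies
      between 0 and the indicator of the shell, the average against it inherits the Lipschitz
      constant of \<open>h\<close> times the shell volume.\<close>
    define b where "b x = indicator (cball 0 1) x - c r * (a 1 x - a r x)" for x :: 'a
    have b: "0 \<le> b x" "b x \<le> indicator (S r) x" for x
    proof -
      have cc: "c r * ((1 - r\<^sup>2) / 2) = 1" using c[OF r] by (simp add: c_def field_simps)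
      have r2: "r\<^sup>2 < 1" using r by (simp add: power_less_one_iff)
      consider "norm x \<le> r" | "r < norm x" "norm x \<le> 1" | "1 < norm x" by linarith
      then have "0 \<le> b x \<and> b x \<le> indicator (S r) x"
      proof cases
        case 1
        then have "(norm x)\<^sup>2 \<le> r\<^sup>2" by (intro power_mono) auto
        then have "a 1 x - a r x = (1 - r\<^sup>2) / 2" using r2 by (simp add: a_def field_simps)
        then have "c r * (a 1 x - a r x) = 1" using cc by (simp only:)
        then show ?thesis using 1 r by (simp add: b_def S_def)
      next
        case 2
        have "r\<^sup>2 \<le> (norm x)\<^sup>2" using 2 r by (intro power_mono) auto
        moreover have "(norm x)\<^sup>2 \<le> 1" using 2 by (simp add: power_le_one)
        ultimately have "a 1 x - a r x = (1 - (norm x)\<^sup>2) / 2" "0 \<le> a 1 x - a r x" "a 1 x - a r x \<le> (1 - r\<^sup>2) / 2"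
          by (auto simp: a_def)
        then have "0 \<le> c r * (a 1 x - a r x)" "c r * (a 1 x - a r x) \<le> 1"
          using c[OF r] cc mult_left_mono[of "a 1 x - a r x" "(1 - r\<^sup>2) / 2" "c r"] by auto
        then show ?thesis using 2 by (simp add: b_def S_def)
      next
        case 3
        then have "1 \<le> (norm x)\<^sup>2" by simp
        then have "a 1 x = 0" "a r x = 0" using r2 by (auto simp: a_def)
        then show ?thesis using 3 r by (simp add: b_def S_def)
      qed
      then show "0 \<le> b x" "b x \<le> indicator (S r) x" by auto
    qed
    have bt: "integrable lborel (\<lambda>x. b x * h (t + x))"
        "J t - c r * (A 1 t - A r t) = (\<integral>x. b x * h (t + x) \<partial>lborel)" for t
    proof -
      have eq: "(\<lambda>x. b x * h (t + x)) = (\<lambda>x. indicator (cball 0 1) x * h (t + x)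
          - c r * (a 1 x * h (t + x) - a r x * h (t + x)))"
        by (auto simp: b_def algebra_simps)
      show "integrable lborel (\<lambda>x. b x * h (t + x))"
        unfolding eq using r aint Jint by auto
      show "J t - c r * (A 1 t - A r t) = (\<integral>x. b x * h (t + x) \<partial>lborel)"
        unfolding eq using r aint[of 1 t] aint[of r t] Jint[of t]
        by (simp add: J_def A_def set_lebesgue_integral_def)
    qed
    have "\<bar>(J y - c r * (A 1 y - A r y)) - (J \<theta> - c r * (A 1 \<theta> - A r \<theta>))\<bar>
        = norm (\<integral>x. b x * h (y + x) - b x * h (\<theta> + x) \<partial>lborel)"
      unfolding bt(2) using bt(1) by simp
    also have "\<dots> \<le> (\<integral>x. indicator (S r) x *\<^sub>R (L * norm (y - \<theta>)) \<partial>lborel)"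
    proof (rule Bochner_Integration.integral_norm_bound_integral)
      show "integrable lborel (\<lambda>x. b x * h (y + x) - b x * h (\<theta> + x))" using bt(1) by auto
      show "integrable lborel (\<lambda>x. indicator (S r) x *\<^sub>R (L * norm (y - \<theta>)))"
        unfolding set_integrable_def[symmetric]
        by (rule set_integrable_lborel_bounded[where C = "\<bar>L * norm (y - \<theta>)\<bar>"]) (use S in auto)
      fix x
      have "\<bar>b x\<bar> * \<bar>h (y + x) - h (\<theta> + x)\<bar> \<le> indicator (S r) x * (L * norm (y - \<theta>))"
        using b[of x] lip[of "y + x" "\<theta> + x"] by (intro mult_mono) auto
      then show "norm (b x * h (y + x) - b x * h (\<theta> + x)) \<le> indicator (S r) x *\<^sub>R (L * norm (y - \<theta>))"
        by (simp add: abs_mult[symmetric] right_diff_distrib)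
    qed
    also have "\<dots> = L * (V * (1 - r ^ n)) * norm (y - \<theta>)"
      using S emeasure_bounded_finite[of "S r"] mS[OF r]
      by (simp add: set_lebesgue_integral_def[symmetric] set_integral_const)
    finally show ?thesis .
  qed
  have "GDERIV J \<theta> :> real n *\<^sub>R Q"
    unfolding gderiv_def has_derivative_at_alt
  proof (intro conjI allI impI)
    show "bounded_linear (\<lambda>w. w \<bullet> (real n *\<^sub>R Q))" by (rule bounded_linear_inner_left)
    fix e :: real assume e: "e > 0"
    have lim1: "((\<lambda>r. L * (V * (1 - r ^ n))) \<longlongrightarrow> L * (V * (1 - 1 ^ n))) (at_left (1::real))"
      by (intro tendsto_intros)
    have lim2: "(\<beta> \<longlongrightarrow> \<bar>2 / (1 + 1) * (\<Sum>i<n. 1 ^ i) - n\<bar> * norm Q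
     + 2 / (1 + 1) * ((L + K) * (V * (1 - 1 ^ n)))) (at_left (1::real))"
      unfolding \<beta>_def by (intro tendsto_intros) auto
    \<comment> \<open>The radius \<open>r\<close> is fixed from \<open>e\<close> alone, settling two
      of the three error terms. The neighbourhood then comes from differentiability at this fixed
      \<open>r\<close>.\<close>
    have "eventually (\<lambda>r. L * (V * (1 - r ^ n)) < e / 3) (at_left (1::real))"
      by (rule order_tendstoD(2)[OF lim1]) (use e in auto)
    moreover have "eventually (\<lambda>r. \<beta> r < e / 3) (at_left (1::real))"
      by (rule order_tendstoD(2)[OF lim2]) (use e in auto)
    moreover have "eventually (\<lambda>r. r < 1) (at_left (1::real))" "eventually (\<lambda>r. 0 < r) (at_left (1::real))"
      using eventually_at_left_real[of 0 "1::real"] by (auto elim: eventually_mono)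
    ultimately have "eventually (\<lambda>r. L * (V * (1 - r ^ n)) < e / 3 \<and> \<beta> r < e / 3 \<and> 0 < r \<and> r < 1) (at_left (1::real))"
      by eventually_elim auto
    then obtain r where r: "L * (V * (1 - r ^ n)) < e / 3" "\<beta> r < e / 3" "0 < r" "r < 1"
      using eventually_happens[of _ "at_left (1::real)"] by (auto simp: trivial_limit_at_left_real)
    have "GDERIV (\<lambda>t. c r * (A 1 t - A r t)) \<theta> :> c r *\<^sub>R (G 1 - G r)"
      using GDERIV_mult[OF GDERIV_const[of "c r"] GDERIV_diff[OF A[of 1] A[OF r(3)]]] by simp
    then obtain d where d: "d > 0" "\<And>y. norm (y - \<theta>) < d \<Longrightarrow>
        norm (c r * (A 1 y - A r y) - c r * (A 1 \<theta> - A r \<theta>) - (y - \<theta>) \<bullet> (c r *\<^sub>R (G 1 - G r)))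
          \<le> e / 3 * norm (y - \<theta>)"
      unfolding gderiv_def has_derivative_at_alt using e by (meson divide_pos_pos zero_less_numeral)
    have "norm (J y - J \<theta> - (y - \<theta>) \<bullet> (real n *\<^sub>R Q)) \<le> e * norm (y - \<theta>)" if y: "norm (y - \<theta>) < d" for y
    proof -
      have "\<bar>(J y - c r * (A 1 y - A r y)) - (J \<theta> - c r * (A 1 \<theta> - A r \<theta>))\<bar> \<le> e / 3 * norm (y - \<theta>)"
        using increment_close[OF r(3,4), of y] mult_right_mono[OF less_imp_le[OF r(1)], of "norm (y - \<theta>)"]
        by simp
      moreover have "\<bar>(y - \<theta>) \<bullet> (c r *\<^sub>R (G 1 - G r) - real n *\<^sub>R Q)\<bar> \<le> norm (y - \<theta>) * (e / 3)"
        using gradient_close[OF r(3,4)] r(2)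
        by (intro order_trans[OF Cauchy_Schwarz_ineq2] mult_left_mono) auto
      moreover have eq: "J y - J \<theta> - (y - \<theta>) \<bullet> (real n *\<^sub>R Q) =
         ((J y - c r * (A 1 y - A r y)) - (J \<theta> - c r * (A 1 \<theta> - A r \<theta>)))
         + (c r * (A 1 y - A r y) - c r * (A 1 \<theta> - A r \<theta>) - (y - \<theta>) \<bullet> (c r *\<^sub>R (G 1 - G r)))
         + (y - \<theta>) \<bullet> (c r *\<^sub>R (G 1 - G r) - real n *\<^sub>R Q)"
        by (simp add: inner_diff_right)
      ultimately have "norm (J y - J \<theta> - (y - \<theta>) \<bullet> (real n *\<^sub>R Q))
          \<le> e / 3 * norm (y - \<theta>) + e / 3 * norm (y - \<theta>) + norm (y - \<theta>) * (e / 3)"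
        using d(2)[OF y] unfolding eq by (intro norm_triangle_mono) (simp_all only: real_norm_def)
      then show ?thesis by (simp add: field_simps)
    qed
    then show "\<exists>d>0. \<forall>y. norm (y - \<theta>) < d \<longrightarrow>
        norm (J y - J \<theta> - (y - \<theta>) \<bullet> (real n *\<^sub>R Q)) \<le> e * norm (y - \<theta>)"
      using d(1) by blast
  qed
  then show ?thesis by (simp add: J_def[abs_def] Q_def H_def n_def)
qed

section \<open>Descent inequalities and stochastic gradient descent\<close>

text \<open>Two vectors representing the same derivative agree when both functionals are tested on
  their difference.\<close>

lemma GDERIV_unique:
  assumes "GDERIV f x :> D" "GDERIV f x :> D'"
  shows "D = D'"
proof -
  have "(\<lambda>w. w \<bullet> D) = (\<lambda>w. w \<bullet> D')"
    using assms unfolding gderiv_def by (rule has_derivative_unique)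
  then have "(D - D') \<bullet> D = (D - D') \<bullet> D'" by (rule fun_cong)
  then have "(D - D') \<bullet> (D - D') = 0" by (simp only: inner_diff_right[of "D - D'"] diff_self)
  then show ?thesis by simp
qed

lemma gradient_eqI: "GDERIV f x :> D \<Longrightarrow> gradient f x = D"
  unfolding gradient_def by (blast intro: GDERIV_unique)

text \<open>Along the segment from \<open>x\<close> to \<open>y\<close>, the function minus its
  quadratic upper model has nonpositive derivative, by Cauchy-Schwarz and the Lipschitz bound on
  \<open>g\<close>.\<close>

lemma descent_lemma:
  fixes f :: "'a::real_inner \<Rightarrow> real"
  assumes deriv: "\<And>x. GDERIV f x :> g x" and lip: "\<And>x y. norm (g x - g y) \<le> M * norm (x - y)"
  shows "f y \<le> f x + g x \<bullet> (y - x) + M / 2 * (norm (y - x))\<^sup>2"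
proof -
  define w where "w = y - x"
  define \<phi> where "\<phi> t = f (x + t *\<^sub>R w) - t * (g x \<bullet> w) - M / 2 * t\<^sup>2 * (norm w)\<^sup>2" for t
  have f: "((\<lambda>t. f (x + t *\<^sub>R w)) has_real_derivative g (x + t *\<^sub>R w) \<bullet> w) (at t)" for t
  proof -
    have "((\<lambda>t. f (x + t *\<^sub>R w)) has_derivative (\<lambda>s. (s *\<^sub>R w) \<bullet> g (x + t *\<^sub>R w))) (at t)"
      using deriv[of "x + t *\<^sub>R w"] unfolding gderiv_def
      by (rule has_derivative_compose[rotated]) (auto intro!: derivative_eq_intros)
    then show ?thesis by (simp add: has_field_derivative_def mult_commute_abs inner_commute)
  qed
  have "\<phi> 1 \<le> \<phi> 0"
  proof (rule DERIV_nonpos_imp_nonincreasing[of 0 1])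
    fix t :: real assume t: "0 \<le> t" "t \<le> 1"
    have "(\<phi> has_real_derivative (g (x + t *\<^sub>R w) \<bullet> w - g x \<bullet> w - M * t * (norm w)\<^sup>2)) (at t)"
      unfolding \<phi>_def by (rule derivative_eq_intros f refl | simp)+
    moreover have "(g (x + t *\<^sub>R w) - g x) \<bullet> w \<le> M * norm (t *\<^sub>R w) * norm w"
      using lip[of "x + t *\<^sub>R w" x]
      by (intro order_trans[OF norm_cauchy_schwarz] mult_right_mono) auto
    ultimately show "\<exists>z. (\<phi> has_real_derivative z) (at t) \<and> z \<le> 0"
      using t by (intro exI conjI) (assumption, simp add: inner_diff_left power2_eq_square)
  qed simp
  then show ?thesis by (simp add: \<phi>_def w_def)
qed

section \<open>The squared distance to a closed convex set\<close>

lemma infdist_eq_dist_closest_point: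
  assumes "closed S" "S \<noteq> {}"
  shows "infdist x S = norm (x - closest_point S x)"
  unfolding dist_norm[symmetric]
  using assms
  by (intro antisym infdist_le closest_point_in_set)
     (auto simp: infdist_notempty intro!: cINF_greatest closest_point_le)

context
  fixes S :: "'a::euclidean_space set"
  assumes S: "closed S" "convex S" "S \<noteq> {}"
begin

text \<open>The projection of \<open>x\<close> is a competitor for the distance from
  \<open>y\<close>; expanding the square gives the bound.\<close>

lemma infdist_sq_upper:
  "(infdist y S)\<^sup>2 \<le> (infdist x S)\<^sup>2 + 2 * ((x - closest_point S x) \<bullet> (y - x)) + (norm (y - x))\<^sup>2"
proof -
  have "infdist y S \<le> norm (y - closest_point S x)"
    using S closest_point_in_set by (metis dist_norm infdist_le)
  then have "(infdist y S)\<^sup>2 \<le> (norm ((x - closest_point S x) + (y - x)))\<^sup>2"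
    by (intro power_mono) (auto simp: infdist_nonneg)
  also have "\<dots> = (infdist x S)\<^sup>2 + 2 * ((x - closest_point S x) \<bullet> (y - x)) + (norm (y - x))\<^sup>2"
    by (simp only: infdist_eq_dist_closest_point[OF S(1,3)] power2_norm_eq_inner inner_add inner_commute)
  finally show ?thesis .
qed

text \<open>The upper bound with \<open>x\<close> and \<open>y\<close> exchanged involves the
  residual at \<open>y\<close>. Nonexpansiveness of the projection replaces it by the residual at
  \<open>x\<close>.\<close>

lemma infdist_sq_lower:
  "(infdist y S)\<^sup>2 \<ge> (infdist x S)\<^sup>2 + 2 * ((x - closest_point S x) \<bullet> (y - x)) - (norm (y - x))\<^sup>2"
proof -
  define p where "p = closest_point S"
  have "norm (p y - p x) \<le> norm (y - x)"
    using closest_point_lipschitz[OF S(2,1,3)] by (simp add: dist_norm p_def)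
  then have "(p y - p x) \<bullet> (y - x) \<le> norm (y - x) * norm (y - x)"
    by (intro order_trans[OF norm_cauchy_schwarz] mult_right_mono) auto
  then have "(x - p x) \<bullet> (y - x) \<le> (y - p y) \<bullet> (y - x)"
    by (simp add: power2_norm_eq_inner[unfolded power2_eq_square] inner_diff_left)
  moreover have "(infdist x S)\<^sup>2 \<le> (infdist y S)\<^sup>2 + 2 * ((y - p y) \<bullet> (x - y)) + (norm (x - y))\<^sup>2"
    unfolding p_def by (rule infdist_sq_upper)
  moreover have "(y - p y) \<bullet> (x - y) = - ((y - p y) \<bullet> (y - x))"
    by (simp add: inner_diff_right)
  ultimately show ?thesis by (simp add: p_def norm_minus_commute)
qed

text \<open>The upper and lower bounds leave a remainder of at most
  \<open>(norm (y - x))\<^sup>2\<close>, so the radius \<open>e\<close> itself works as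
  \<delta>.\<close>

lemma GDERIV_infdist_sq: "GDERIV (\<lambda>x. (infdist x S)\<^sup>2) x :> 2 *\<^sub>R (x - closest_point S x)"
  unfolding gderiv_def has_derivative_at_alt
proof (intro conjI allI impI)
  show "bounded_linear (\<lambda>w. w \<bullet> (2 *\<^sub>R (x - closest_point S x)))" by (rule bounded_linear_inner_left)
  fix e :: real assume e: "e > 0"
  have "norm ((infdist y S)\<^sup>2 - (infdist x S)\<^sup>2 - (y - x) \<bullet> (2 *\<^sub>R (x - closest_point S x))) \<le> e * norm (y - x)"
    if "norm (y - x) < e" for y
  proof -
    have "\<bar>(infdist y S)\<^sup>2 - (infdist x S)\<^sup>2 - (y - x) \<bullet> (2 *\<^sub>R (x - closest_point S x))\<bar> \<le> (norm (y - x))\<^sup>2"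
      using infdist_sq_upper[of y x] infdist_sq_lower[of x y]
      by (simp add: abs_le_iff inner_commute[of "y - x"])
    also have "\<dots> \<le> e * norm (y - x)"
      unfolding power2_eq_square using that by (intro mult_right_mono) auto
    finally show ?thesis by simp
  qed
  then show "\<exists>d>0. \<forall>y. norm (y - x) < d \<longrightarrow>
      norm ((infdist y S)\<^sup>2 - (infdist x S)\<^sup>2 - (y - x) \<bullet> (2 *\<^sub>R (x - closest_point S x))) \<le> e * norm (y - x)"
    using e by blast
qed

end

section \<open>Stochastic gradient descent with bounded unbiased noise\<close>

text \<open>This serves to show that an iterate is independent of the direction drawn next: it is
  determined by the earlier directions, and \<open>{..<k}\<close> and \<open>{k}\<close> are
  disjoint index blocks.\<close>

lemma (in prob_space) indep_var_adapted:
  fixes U :: "nat \<Rightarrow> 'a \<Rightarrow> 'b::euclidean_space" and T :: "(nat \<Rightarrow> 'b) \<Rightarrow> 'b"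
  assumes ind: "indep_vars (\<lambda>_. borel) U I" and k: "k \<in> I" "{..<k} \<subseteq> I"
    and T: "T \<in> borel_measurable (Pi\<^sub>M {..<k} (\<lambda>_. borel))"
    and adapted: "\<And>u v. (\<And>i. i < k \<Longrightarrow> u i = v i) \<Longrightarrow> T u = T v"
  shows "indep_var borel (\<lambda>\<omega>. T (\<lambda>i. U i \<omega>)) borel (U k)"
proof -
  have "indep_var borel (T \<circ> (\<lambda>\<omega>. restrict (\<lambda>i. U i \<omega>) {..<k})) borel ((\<lambda>f. f k) \<circ> (\<lambda>\<omega>. restrict (\<lambda>i. U i \<omega>) {k}))"
    using k by (intro indep_var_compose[OF indep_var_restrict[OF ind]] T measurable_component_singleton) auto
  moreover have "T \<circ> (\<lambda>\<omega>. restrict (\<lambda>i. U i \<omega>) {..<k}) = (\<lambda>\<omega>. T (\<lambda>i. U i \<omega>))"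
    by (auto simp: fun_eq_iff intro!: adapted)
  moreover have "(\<lambda>f. f k) \<circ> (\<lambda>\<omega>. restrict (\<lambda>i. U i \<omega>) {k}) = U k" by auto
  ultimately show ?thesis by simp
qed

text \<open>In the expected smoothness inequality the noise cross term vanishes by independence, and
  the step size restriction preserves half of the squared gradient. Summation telescopes the values
  of \<open>P\<close>, and the lower bound \<open>p\<close> closes the estimate.\<close>

theorem (in prob_space) stochastic_gradient_descent:
  fixes P :: "'b::euclidean_space \<Rightarrow> real" and G :: "'b \<Rightarrow> 'b" and g :: "'b \<Rightarrow> 'b \<Rightarrow> 'b"
    and U :: "nat \<Rightarrow> 'a \<Rightarrow> 'b" and x :: "(nat \<Rightarrow> 'b) \<Rightarrow> nat \<Rightarrow> 'b"
  assumes x: "\<And>u. x u 0 = x0" "\<And>u k. x u (Suc k) = x u k - \<alpha> *\<^sub>R g (x u k) (u k)"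
    and ind: "indep_vars (\<lambda>_. borel) U {..<K}" and D: "\<And>k. k < K \<Longrightarrow> distr M borel (U k) = D"
    and P: "continuous_on UNIV P" "\<And>x. p \<le> P x" and G: "continuous_on UNIV G"
    and smooth: "\<And>x y. P y \<le> P x + G x \<bullet> (y - x) + L / 2 * (norm (y - x))\<^sup>2"
    and g: "(\<lambda>z. g (fst z) (snd z)) \<in> borel_measurable borel"
    and unbiased: "\<And>x. integrable D (g x)" "\<And>x. (\<integral>u. g x u \<partial>D) = G x"
    and noise: "AE u in D. \<forall>x. norm (g x u - G x) \<le> \<sigma>"
    and \<alpha>: "0 < \<alpha>" "0 \<le> L" "L * \<alpha> \<le> 1 / 2"
  shows "k < K \<Longrightarrow> integrable M (\<lambda>\<omega>. (norm (G (x (\<lambda>j. U j \<omega>) k)))\<^sup>2)"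
    and "(\<Sum>k<K. expectation (\<lambda>\<omega>. (norm (G (x (\<lambda>j. U j \<omega>) k)))\<^sup>2))
      \<le> 2 * (P x0 - p) / \<alpha> + 2 * L * \<sigma>\<^sup>2 * \<alpha> * real K"
proof -
  have U [measurable]: "U k \<in> borel_measurable M" if "k < K" for k
    using ind that unfolding indep_vars_def by auto
  have [measurable]: "P \<in> borel_measurable borel" "G \<in> borel_measurable borel"
    using P G by (auto intro: borel_measurable_continuous_onI)
  have g2: "(\<lambda>\<omega>. g (X \<omega>) (Y \<omega>)) \<in> borel_measurable N"
    if "X \<in> borel_measurable N" "Y \<in> borel_measurable N" for X Y and N :: "'d measure"
    using measurable_compose[OF borel_measurable_Pair[OF that] g] by simp
  define X where "X k \<omega> = x (\<lambda>j. U j \<omega>) k" for k \<omega>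
  have X_Suc: "X (Suc k) \<omega> = X k \<omega> - \<alpha> *\<^sub>R g (X k \<omega>) (U k \<omega>)" for k \<omega>
    by (simp add: X_def x)
  have X [measurable]: "X k \<in> borel_measurable M" if "k \<le> K" for k
    using that
  proof (induction k)
    case (Suc k)
    then show ?case unfolding X_Suc[abs_def]
      by (intro borel_measurable_diff borel_measurable_scaleR g2) auto
  qed (simp add: X_def[abs_def] x)
  \<comment> \<open>Allowing any \<open>I\<close> that contains the first \<open>k\<close> indices
    keeps a single product space throughout the induction.\<close>
  have xm: "(\<lambda>u. x u k) \<in> borel_measurable (Pi\<^sub>M I (\<lambda>_. borel))" if "{..<k} \<subseteq> I" for k I
    using that
  proof (induction k)
    case (Suc k)
    from Suc.prems have "{..<k} \<subseteq> I" "k \<in> I" by auto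
    with Suc.IH have "(\<lambda>u. x u k) \<in> borel_measurable (Pi\<^sub>M I (\<lambda>_. borel))"
      "(\<lambda>u. u k) \<in> borel_measurable (Pi\<^sub>M I (\<lambda>_. borel))"
      by (auto intro!: measurable_component_singleton)
    then show ?case unfolding x
      by (intro borel_measurable_diff borel_measurable_scaleR g2) auto
  qed (simp add: x)
  have adapted: "x u k = x v k" if "\<And>i. i < k \<Longrightarrow> u i = v i" for u v k
    using that by (induction k) (simp_all add: x)
  have indep: "indep_var borel (X k) borel (U k)" if "k < K" for k
    unfolding X_def using that by (intro indep_var_adapted[OF ind] xm adapted) auto
  \<comment> \<open>The exceptional null set is common to all \<open>x\<close>, so the bound may be
    used at the random iterate.\<close>
  have noise_AE: "AE \<omega> in M. \<forall>x. norm (g x (U k \<omega>) - G x) \<le> \<sigma>" if "k < K" for k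
    using noise unfolding D[OF that, symmetric] by (intro AE_distrD[OF U[OF that]])
  have G_bdd: "\<exists>B. \<forall>x. norm x \<le> R \<longrightarrow> norm (f x) \<le> B"
    if "continuous_on UNIV f" for R and f :: "'b \<Rightarrow> 'e::real_normed_vector"
  proof -
    have "bounded (f ` cball 0 R)"
      using that by (intro compact_imp_bounded compact_continuous_image continuous_on_subset[OF that]) auto
    then obtain B where "\<forall>x\<in>cball 0 R. norm (f x) \<le> B" unfolding bounded_iff by auto
    then show ?thesis by (intro exI[of _ B]) auto
  qed
  \<comment> \<open>Bounded noise and a gradient bounded on balls keep each iterate essentially
    bounded, with a bound that may depend on \<open>k\<close>. This makes all expectations below
    finite.\<close>
  have X_bdd: "\<exists>R. AE \<omega> in M. norm (X k \<omega>) \<le> R" if "k \<le> K" for k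
    using that
  proof (induction k)
    case 0
    then show ?case by (auto simp: X_def x)
  next
    case (Suc k)
    then obtain R where R: "AE \<omega> in M. norm (X k \<omega>) \<le> R" by auto
    obtain B where B: "\<And>x. norm x \<le> R \<Longrightarrow> norm (G x) \<le> B" using G_bdd[OF G] by blast
    have "AE \<omega> in M. norm (X (Suc k) \<omega>) \<le> R + \<alpha> * (\<sigma> + B)"
      using R noise_AE[OF Suc_le_lessD[OF Suc.prems]]
    proof eventually_elim
      case (elim \<omega>)
      have "norm (g (X k \<omega>) (U k \<omega>)) \<le> norm (g (X k \<omega>) (U k \<omega>) - G (X k \<omega>)) + norm (G (X k \<omega>))"
        by (metis diff_add_cancel norm_triangle_ineq)
      also have "\<dots> \<le> \<sigma> + B" using elim B by (intro add_mono) auto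
      finally have "norm (\<alpha> *\<^sub>R g (X k \<omega>) (U k \<omega>)) \<le> \<alpha> * (\<sigma> + B)"
        using \<alpha>(1) by simp
      then show ?case unfolding X_Suc
        by (rule order_trans[OF norm_triangle_ineq4 add_mono[OF elim(1)]])
    qed
    then show ?case by blast
  qed
  have int: "integrable M (\<lambda>\<omega>. f (X k \<omega>))" if k: "k \<le> K" and f: "continuous_on UNIV f"
    for k and f :: "'b \<Rightarrow> real"
  proof -
    obtain R where R: "AE \<omega> in M. norm (X k \<omega>) \<le> R" using X_bdd[OF k] by blast
    obtain B where B: "\<And>x. norm x \<le> R \<Longrightarrow> norm (f x) \<le> B" using G_bdd[OF f] by blast
    have "f \<in> borel_measurable borel" using f by (rule borel_measurable_continuous_onI)
    then show ?thesis using R B X[OF k]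
      by (intro integrable_const_bound[where B = B]) (auto elim: eventually_mono intro: measurable_compose)
  qed
  have G2: "continuous_on UNIV (\<lambda>x. (norm (G x))\<^sup>2)"
    by (intro continuous_intros G)
  show sq: "integrable M (\<lambda>\<omega>. (norm (G (x (\<lambda>j. U j \<omega>) k)))\<^sup>2)" if "k < K" for k
    using int[OF less_imp_le[OF that] G2] by (simp add: X_def)
  define \<Phi> where "\<Phi> z = G (fst z) \<bullet> (g (fst z) (snd z) - G (fst z))" for z
  have \<Phi>m [measurable]: "\<Phi> \<in> borel_measurable (borel \<Otimes>\<^sub>M borel)"
  proof -
    have "(\<lambda>z. G (fst z)) \<in> borel_measurable (borel \<Otimes>\<^sub>M (borel :: 'b measure))" by measurable
    then show ?thesis unfolding \<Phi>_def using g
      by (intro borel_measurable_inner borel_measurable_diff) (simp_all add: borel_prod)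
  qed
  have \<Phi>: "integrable M (\<lambda>\<omega>. \<Phi> (X k \<omega>, U k \<omega>))" "expectation (\<lambda>\<omega>. \<Phi> (X k \<omega>, U k \<omega>)) = 0"
    if k: "k < K" for k
  proof -
    have m: "(\<lambda>\<omega>. (X k \<omega>, U k \<omega>)) \<in> M \<rightarrow>\<^sub>M borel \<Otimes>\<^sub>M borel"
      using X[OF less_imp_le[OF k]] U[OF k] by (rule measurable_Pair)
    obtain R where R: "AE \<omega> in M. norm (X k \<omega>) \<le> R" using X_bdd k by (meson less_imp_le)
    obtain B where B: "\<And>x. norm x \<le> R \<Longrightarrow> norm (G x) \<le> B" using G_bdd[OF G] by blast
    have "AE \<omega> in M. norm (\<Phi> (X k \<omega>, U k \<omega>)) \<le> B * \<sigma>"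
      using R noise_AE[OF k]
    proof eventually_elim
      case (elim \<omega>)
      have "\<bar>\<Phi> (X k \<omega>, U k \<omega>)\<bar> \<le> norm (G (X k \<omega>)) * norm (g (X k \<omega>) (U k \<omega>) - G (X k \<omega>))"
        unfolding \<Phi>_def fst_conv snd_conv by (rule Cauchy_Schwarz_ineq2)
      also have "\<dots> \<le> B * \<sigma>"
        using B[OF elim(1)] elim(2) order_trans[OF norm_ge_zero B[OF elim(1)]] by (intro mult_mono) auto
      finally show ?case by simp
    qed
    then show i: "integrable M (\<lambda>\<omega>. \<Phi> (X k \<omega>, U k \<omega>))"
      by (intro integrable_const_bound[where B = "B * \<sigma>"]) (use m in \<open>auto intro: measurable_compose\<close>)
    interpret D: prob_space D unfolding D[OF k, symmetric] using k by (intro prob_space_distr) simp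
    interpret X: prob_space "distr M borel (X k)" using k by (intro prob_space_distr) simp
    interpret XD: pair_sigma_finite "distr M borel (X k)" D ..
    \<comment> \<open>Independence turns the joint law into a product, so Fubini can average over
      the fresh direction with the iterate held fixed.\<close>
    have prod: "distr M (borel \<Otimes>\<^sub>M borel) (\<lambda>\<omega>. (X k \<omega>, U k \<omega>)) = distr M borel (X k) \<Otimes>\<^sub>M D"
      using indep[OF k] unfolding indep_var_distribution_eq by (simp add: D[OF k])
    have "expectation (\<lambda>\<omega>. \<Phi> (X k \<omega>, U k \<omega>)) = (\<integral>z. \<Phi> z \<partial>(distr M borel (X k) \<Otimes>\<^sub>M D))"
      unfolding prod[symmetric] by (subst integral_distr[OF m \<Phi>m]) simp
    also have "\<dots> = (\<integral>y. (\<integral>u. \<Phi> (y, u) \<partial>D) \<partial>distr M borel (X k))"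
      by (rule XD.integral_fst'[symmetric]) (use i in \<open>simp add: prod[symmetric] integrable_distr_eq[OF m \<Phi>m]\<close>)
    also have "\<dots> = 0"
      using unbiased by (simp add: \<Phi>_def D.prob_space)
    finally show "expectation (\<lambda>\<omega>. \<Phi> (X k \<omega>, U k \<omega>)) = 0" .
  qed
  have descent: "\<alpha> / 2 * expectation (\<lambda>\<omega>. (norm (G (X k \<omega>)))\<^sup>2)
      \<le> expectation (\<lambda>\<omega>. P (X k \<omega>)) - expectation (\<lambda>\<omega>. P (X (Suc k) \<omega>)) + L * \<alpha>\<^sup>2 * \<sigma>\<^sup>2" if k: "k < K" for k
  proof -
    have AE: "AE \<omega> in M. P (X (Suc k) \<omega>) \<le>
        P (X k \<omega>) - \<alpha> * \<Phi> (X k \<omega>, U k \<omega>) - \<alpha> / 2 * (norm (G (X k \<omega>)))\<^sup>2 + L * \<alpha>\<^sup>2 * \<sigma>\<^sup>2"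
      using noise_AE[OF k]
    proof eventually_elim
      case (elim \<omega>)
      define a where "a = G (X k \<omega>)"
      define b where "b = g (X k \<omega>) (U k \<omega>) - a"
      have b: "norm b \<le> \<sigma>" using elim by (simp add: a_def b_def)
      have step: "X (Suc k) \<omega> - X k \<omega> = - (\<alpha> *\<^sub>R (a + b))" by (simp add: X_Suc b_def)
      \<comment> \<open>The parallelogram law, with \<open>(norm (a - b))\<^sup>2\<close> dropped,
        bounds the squared step by gradient and noise.\<close>
      have "(norm (a + b))\<^sup>2 + (norm (a - b))\<^sup>2 = 2 * (norm a)\<^sup>2 + 2 * (norm b)\<^sup>2"
        by (simp add: power2_norm_eq_inner inner_add inner_diff inner_commute)
      moreover have "(norm b)\<^sup>2 \<le> \<sigma>\<^sup>2" using b by (intro power_mono) auto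
      ultimately have sq: "(norm (a + b))\<^sup>2 \<le> 2 * (norm a)\<^sup>2 + 2 * \<sigma>\<^sup>2"
        using zero_le_power2[of "norm (a - b)"] by linarith
      have "P (X (Suc k) \<omega>) \<le> P (X k \<omega>) + a \<bullet> (- (\<alpha> *\<^sub>R (a + b))) + L / 2 * (norm (- (\<alpha> *\<^sub>R (a + b))))\<^sup>2"
        using smooth[of "X (Suc k) \<omega>" "X k \<omega>"] unfolding step a_def .
      also have "\<dots> = P (X k \<omega>) - \<alpha> * (a \<bullet> b) - \<alpha> * (norm a)\<^sup>2 + L / 2 * \<alpha>\<^sup>2 * (norm (a + b))\<^sup>2"
        by (simp add: power2_norm_eq_inner inner_add_right power_mult_distrib)
          (simp add: algebra_simps power2_eq_square add_divide_distrib)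
      also have "\<dots> \<le> P (X k \<omega>) - \<alpha> * (a \<bullet> b) - \<alpha> * (norm a)\<^sup>2 + L / 2 * \<alpha>\<^sup>2 * (2 * (norm a)\<^sup>2 + 2 * \<sigma>\<^sup>2)"
        using sq \<alpha> by (intro add_left_mono mult_left_mono) auto
      also have "\<dots> = P (X k \<omega>) - \<alpha> * (a \<bullet> b) - \<alpha> * (norm a)\<^sup>2 + (L * \<alpha>) * (\<alpha> * (norm a)\<^sup>2) + L * \<alpha>\<^sup>2 * \<sigma>\<^sup>2"
        by (simp add: algebra_simps power2_eq_square)
      \<comment> \<open>Here \<open>L * \<alpha> \<le> 1 / 2\<close> absorbs half of the decrease
        \<open>\<alpha> * (norm a)\<^sup>2\<close>.\<close>
      also have "(L * \<alpha>) * (\<alpha> * (norm a)\<^sup>2) \<le> 1 / 2 * (\<alpha> * (norm a)\<^sup>2)"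
        using \<alpha> by (intro mult_right_mono) auto
      finally show ?case by (simp add: \<Phi>_def a_def b_def algebra_simps)
    qed
    have iP: "integrable M (\<lambda>\<omega>. P (X j \<omega>))" if "j \<le> K" for j using int[OF that P(1)] .
    have iG: "integrable M (\<lambda>\<omega>. (norm (G (X k \<omega>)))\<^sup>2)" using int[OF less_imp_le[OF k] G2] .
    have "expectation (\<lambda>\<omega>. P (X (Suc k) \<omega>)) \<le>
      expectation (\<lambda>\<omega>. P (X k \<omega>) - \<alpha> * \<Phi> (X k \<omega>, U k \<omega>) - \<alpha> / 2 * (norm (G (X k \<omega>)))\<^sup>2 + L * \<alpha>\<^sup>2 * \<sigma>\<^sup>2)"
      using k iP[of k] iP[of "Suc k"] iG \<Phi>(1)[OF k] by (intro integral_mono_AE[OF _ _ AE]) auto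
    also have "\<dots> = expectation (\<lambda>\<omega>. P (X k \<omega>)) - \<alpha> / 2 * expectation (\<lambda>\<omega>. (norm (G (X k \<omega>)))\<^sup>2) + L * \<alpha>\<^sup>2 * \<sigma>\<^sup>2"
      using k iP[of k] iG \<Phi>[OF k] by (simp add: prob_space)
    finally show ?thesis by simp
  qed
  have tele: "(\<Sum>k<K. expectation (\<lambda>\<omega>. P (X k \<omega>)) - expectation (\<lambda>\<omega>. P (X (Suc k) \<omega>)))
      = expectation (\<lambda>\<omega>. P (X 0 \<omega>)) - expectation (\<lambda>\<omega>. P (X K \<omega>))"
    by (rule sum_lessThan_telescope')
  have "p \<le> expectation (\<lambda>\<omega>. P (X K \<omega>))"
    using integral_mono[OF _ int[OF order_refl P(1)], of "\<lambda>_. p"] P(2) by (simp add: prob_space)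
  moreover have "expectation (\<lambda>\<omega>. P (X 0 \<omega>)) = P x0" by (simp add: X_def x prob_space)
  moreover have "\<alpha> / 2 * (\<Sum>k<K. expectation (\<lambda>\<omega>. (norm (G (X k \<omega>)))\<^sup>2))
      \<le> (\<Sum>k<K. expectation (\<lambda>\<omega>. P (X k \<omega>)) - expectation (\<lambda>\<omega>. P (X (Suc k) \<omega>)) + L * \<alpha>\<^sup>2 * \<sigma>\<^sup>2)"
    unfolding sum_distrib_left by (intro sum_mono descent) auto
  ultimately have "\<alpha> / 2 * (\<Sum>k<K. expectation (\<lambda>\<omega>. (norm (G (X k \<omega>)))\<^sup>2))
      \<le> P x0 - p + real K * (L * \<alpha>\<^sup>2 * \<sigma>\<^sup>2)"
    unfolding sum.distrib tele by simp
  then show "(\<Sum>k<K. expectation (\<lambda>\<omega>. (norm (G (x (\<lambda>j. U j \<omega>) k)))\<^sup>2))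
      \<le> 2 * (P x0 - p) / \<alpha> + 2 * L * \<sigma>\<^sup>2 * \<alpha> * real K"
    using \<alpha>(1) by (simp add: X_def field_simps power2_eq_square)
qed

section \<open>The two-point gradient estimate\<close>

lemma sets_uniform_ball [simp, measurable_cong]: "sets uniform_ball = sets borel"
  by (simp add: uniform_ball_def)

lemma sets_uniform_sphere [simp, measurable_cong]: "sets uniform_sphere = sets borel"
  by (simp add: uniform_sphere_def)

lemma integral_uniform_ball:
  fixes g :: "'a::euclidean_space \<Rightarrow> 'b::{banach, second_countable_topology}"
  assumes [measurable]: "g \<in> borel_measurable borel"
  shows "(\<integral>x. g x \<partial>uniform_ball) = (1 / unit_ball_vol (real DIM('a))) *\<^sub>R (LINT x:cball 0 1|lborel. g x)"
proof -
  define V where "V = unit_ball_vol (real DIM('a))"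
  have V: "V > 0" by (simp add: V_def)
  have "emeasure lborel (cball (0::'a) 1) = ennreal V"
    by (simp add: emeasure_cball V_def)
  then have eq: "(uniform_ball :: 'a measure) = density lborel (\<lambda>x. ennreal (indicator (cball 0 1) x / V))"
    unfolding uniform_ball_def uniform_measure_def using V
    by (intro density_cong) (auto simp: indicator_def divide_ennreal[symmetric] simp flip: ennreal_1)
  have [measurable]: "(\<lambda>x::'a. indicator (cball 0 1) x / V) \<in> borel_measurable borel"
    by (intro borel_measurable_divide borel_measurable_indicator) auto
  have "(\<integral>x. g x \<partial>uniform_ball) = (\<integral>x. (indicator (cball 0 1) x / V) *\<^sub>R g x \<partial>lborel)"
    using V unfolding eq by (subst integral_density) auto
  also have "\<dots> = (\<integral>x. (1 / V) *\<^sub>R (indicator (cball 0 1) x *\<^sub>R g x) \<partial>lborel)" by simp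
  also have "\<dots> = (1 / V) *\<^sub>R (LINT x:cball 0 1|lborel. g x)"
    unfolding set_lebesgue_integral_def by (rule integral_scaleR_right)
  finally show ?thesis by (simp add: V_def)
qed

lemma integral_uniform_sphere:
  fixes g :: "'a::euclidean_space \<Rightarrow> 'b::{banach, second_countable_topology}"
  assumes g [measurable]: "g \<in> borel_measurable borel"
  shows "(\<integral>u. g u \<partial>uniform_sphere) =
    (1 / unit_ball_vol (real DIM('a))) *\<^sub>R (LINT x:cball 0 1|lborel. g (sgn x))"
proof -
  have "(\<integral>u. g u \<partial>uniform_sphere) = (\<integral>x. g (sgn x) \<partial>uniform_ball)"
    unfolding uniform_sphere_def by (rule integral_distr) measurable
  also have "\<dots> = (1 / unit_ball_vol (real DIM('a))) *\<^sub>R (LINT x:cball 0 1|lborel. g (sgn x))"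
    by (intro integral_uniform_ball measurable_compose[OF measurable_sgn g])
  finally show ?thesis .
qed

section \<open>The gradient of the ball average and its estimator\<close>

text \<open>Both uniform laws reduce to integrals over the unit ball with the same normalization, so
  the Lebesgue formula carries over.\<close>

lemma GDERIV_ball_average_unit:
  fixes h :: "'a::euclidean_space \<Rightarrow> real"
  assumes lip: "\<And>x y. \<bar>h x - h y\<bar> \<le> L * norm (x - y)"
  shows "GDERIV (\<lambda>t. \<integral>\<nu>. h (t + \<nu>) \<partial>uniform_ball) \<theta> :>
    real DIM('a) *\<^sub>R (\<integral>u. h (\<theta> + u) *\<^sub>R u \<partial>uniform_sphere)"
proof -
  define V where "V = unit_ball_vol (real DIM('a))"
  have h [measurable]: "h \<in> borel_measurable borel"
    using lip by (intro borel_measurable_continuous_onI lipschitz_imp_continuous_UNIV[where L = L]) auto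
  have "GDERIV (\<lambda>t. (1 / V) * (LINT x:cball 0 1|lborel. h (t + x))) \<theta> :>
      (1 / V) *\<^sub>R (real DIM('a) *\<^sub>R (LINT x:cball 0 1|lborel. h (\<theta> + sgn x) *\<^sub>R sgn x))"
    using GDERIV_mult[OF GDERIV_const[of "1 / V"] GDERIV_set_integral_cball[OF lip]] by simp
  moreover have "(\<integral>\<nu>. h (t + \<nu>) \<partial>uniform_ball) = (1 / V) * (LINT x:cball 0 1|lborel. h (t + x))" for t
    by (simp add: integral_uniform_ball V_def)
  moreover have "(\<integral>u. h (\<theta> + u) *\<^sub>R u \<partial>uniform_sphere)
      = (1 / V) *\<^sub>R (LINT x:cball 0 1|lborel. h (\<theta> + sgn x) *\<^sub>R sgn x)"
    unfolding V_def by (rule integral_uniform_sphere) measurable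
  ultimately show ?thesis by (simp add: mult.commute)
qed

text \<open>Apply the unit radius case to \<open>h\<close> rescaled by \<xi>, at the point
  \<open>(1 / \<xi>) *\<^sub>R \<theta>\<close>; the chain rule supplies the factor
  \<open>1 / \<xi>\<close>.\<close>

lemma GDERIV_ball_average:
  fixes h :: "'a::euclidean_space \<Rightarrow> real"
  assumes lip: "\<And>x y. \<bar>h x - h y\<bar> \<le> L * norm (x - y)" and \<xi>: "0 < \<xi>"
  shows "GDERIV (\<lambda>t. \<integral>\<nu>. h (t + \<xi> *\<^sub>R \<nu>) \<partial>uniform_ball) \<theta> :>
    (real DIM('a) / \<xi>) *\<^sub>R (\<integral>u. h (\<theta> + \<xi> *\<^sub>R u) *\<^sub>R u \<partial>uniform_sphere)"
proof -
  have "\<bar>h (\<xi> *\<^sub>R x) - h (\<xi> *\<^sub>R y)\<bar> \<le> (L * \<xi>) * norm (x - y)" for x y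
    using lip[of "\<xi> *\<^sub>R x" "\<xi> *\<^sub>R y"] \<xi> by (simp add: scaleR_diff_right[symmetric] mult.assoc)
  from GDERIV_ball_average_unit[of "\<lambda>x. h (\<xi> *\<^sub>R x)", OF this, of "(1 / \<xi>) *\<^sub>R \<theta>"]
  have "((\<lambda>t. \<integral>\<nu>. h (\<xi> *\<^sub>R ((1 / \<xi>) *\<^sub>R t + \<nu>)) \<partial>uniform_ball) has_derivative
      (\<lambda>w. ((1 / \<xi>) *\<^sub>R w) \<bullet> (real DIM('a) *\<^sub>R (\<integral>u. h (\<xi> *\<^sub>R ((1 / \<xi>) *\<^sub>R \<theta> + u)) *\<^sub>R u \<partial>uniform_sphere)))) (at \<theta>)"
    unfolding gderiv_def by (rule has_derivative_compose[rotated]) (auto intro!: derivative_eq_intros)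
  then show ?thesis
    using \<xi> by (simp add: gderiv_def scaleR_add_right)
qed

lemma integral_uniform_sphere_id: "(\<integral>u. u \<partial>uniform_sphere) = (0 :: 'a::euclidean_space)"
proof -
  \<comment> \<open>The average of the constant function 1 has gradient 0.\<close>
  have "GDERIV (\<lambda>t::'a. \<integral>\<nu>. 1 \<partial>(uniform_ball :: 'a measure)) 0 :> real DIM('a) *\<^sub>R (\<integral>u. 1 *\<^sub>R u \<partial>uniform_sphere)"
    by (rule GDERIV_ball_average_unit[where h = "\<lambda>_. 1" and L = 0]) simp
  from GDERIV_unique[OF this GDERIV_const] show ?thesis by simp
qed

lemma integrable_uniform_sphere:
  fixes g :: "'a::euclidean_space \<Rightarrow> 'b::{banach, second_countable_topology}"
  assumes "g \<in> borel_measurable borel" "\<And>u. norm u = 1 \<Longrightarrow> norm (g u) \<le> B"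
  shows "integrable uniform_sphere g" "norm (\<integral>u. g u \<partial>uniform_sphere) \<le> B"
proof -
  interpret prob_space "uniform_sphere :: 'a measure" by (rule prob_space_uniform_sphere)
  have AE: "AE u in uniform_sphere. norm (g u) \<le> B"
    using AE_uniform_sphere assms(2) by (auto elim: eventually_mono)
  show i: "integrable uniform_sphere g"
    by (rule integrable_const_bound[OF AE]) (use assms(1) in measurable)
  have "norm (\<integral>u. g u \<partial>uniform_sphere) \<le> (\<integral>u. norm (g u) \<partial>uniform_sphere)"
    by (rule integral_norm_bound)
  also have "\<dots> \<le> (\<integral>u. B \<partial>(uniform_sphere :: 'a measure))"
    using i AE by (intro integral_mono_AE) auto
  finally show "norm (\<integral>u. g u \<partial>uniform_sphere) \<le> B" by (simp add: prob_space)
qed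

lemma integrable_uniform_ball:
  fixes g :: "'a::euclidean_space \<Rightarrow> 'b::{banach, second_countable_topology}"
  assumes "g \<in> borel_measurable borel" "\<And>\<nu>. norm \<nu> \<le> 1 \<Longrightarrow> norm (g \<nu>) \<le> B"
  shows "integrable uniform_ball g"
proof -
  interpret prob_space "uniform_ball :: 'a measure" by (rule prob_space_uniform_ball)
  have "AE \<nu> in uniform_ball. norm (g \<nu>) \<le> B"
    unfolding uniform_ball_def using assms(2) by (intro AE_uniform_measureI) auto
  then show ?thesis
    by (rule integrable_const_bound) (use assms(1) in measurable)
qed

text \<open>Subtracting \<open>h \<theta>\<close> leaves the mean unchanged, since the sphere law is
  centered, and reduces the integrand to size \<open>L * \<xi>\<close>. The norm bound is thus
  independent of \<xi> and passes to the mean \<open>G\<close>; the Lipschitz bound compares the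
  integrands pointwise.\<close>

lemma two_point_estimate:
  fixes h :: "'a::euclidean_space \<Rightarrow> real"
  assumes lip: "\<And>x y. \<bar>h x - h y\<bar> \<le> L * norm (x - y)" and \<xi>: "0 < \<xi>"
  defines "G \<equiv> \<lambda>\<theta>. (real DIM('a) / \<xi>) *\<^sub>R (\<integral>u. h (\<theta> + \<xi> *\<^sub>R u) *\<^sub>R u \<partial>uniform_sphere)"
    and "est \<equiv> \<lambda>\<theta> u. (real DIM('a) / \<xi> * (h (\<theta> + \<xi> *\<^sub>R u) - h \<theta>)) *\<^sub>R u"
  shows integrable_two_point_estimate: "integrable uniform_sphere (est \<theta>)"
    and integral_two_point_estimate: "(\<integral>u. est \<theta> u \<partial>uniform_sphere) = G \<theta>"
    and norm_two_point_estimate_le: "norm u = 1 \<Longrightarrow> norm (est \<theta> u) \<le> real DIM('a) * L"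
    and norm_ball_average_gradient_le: "norm (G \<theta>) \<le> real DIM('a) * L"
    and lipschitz_ball_average_gradient: "norm (G \<theta> - G \<theta>') \<le> real DIM('a) * L / \<xi> * norm (\<theta> - \<theta>')"
proof -
  have c: "continuous_on UNIV h"
    using lip by (intro lipschitz_imp_continuous_UNIV[where L = L]) auto
  then have [measurable]: "h \<in> borel_measurable borel" by (rule borel_measurable_continuous_onI)
  have est: "norm (est t v) \<le> real DIM('a) * L" if "norm v = 1" for t and v :: 'a
  proof -
    have "\<bar>h (t + \<xi> *\<^sub>R v) - h t\<bar> \<le> L * \<xi>" using lip[of "t + \<xi> *\<^sub>R v" t] that \<xi> by simp
    then have "real DIM('a) / \<xi> * \<bar>h (t + \<xi> *\<^sub>R v) - h t\<bar> \<le> real DIM('a) / \<xi> * (L * \<xi>)"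
      using \<xi> by (intro mult_left_mono) auto
    then show ?thesis using that \<xi> by (simp add: est_def abs_mult)
  qed
  then show "norm u = 1 \<Longrightarrow> norm (est \<theta> u) \<le> real DIM('a) * L" .
  have m: "est t \<in> borel_measurable borel" for t unfolding est_def by measurable
  note int = integrable_uniform_sphere[OF m est]
  show "integrable uniform_sphere (est \<theta>)" by (rule int)
  have ih: "integrable uniform_sphere (\<lambda>u. h (t + \<xi> *\<^sub>R u) *\<^sub>R u)" for t
  proof (rule integrable_uniform_sphere)
    fix v :: 'a assume v: "norm v = 1"
    show "norm (h (t + \<xi> *\<^sub>R v) *\<^sub>R v) \<le> \<bar>h t\<bar> + L * \<xi>"
      using lip[of "t + \<xi> *\<^sub>R v" t] v \<xi> by simp
  qed measurable
  have iu: "integrable uniform_sphere (\<lambda>u::'a. c *\<^sub>R u)" for c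
    by (rule integrable_uniform_sphere[where B = "\<bar>c\<bar>"]) auto
  have eq: "(\<integral>u. est t u \<partial>uniform_sphere) = G t" for t
  proof -
    have "(\<integral>u. est t u \<partial>uniform_sphere)
        = (\<integral>u. (real DIM('a) / \<xi>) *\<^sub>R (h (t + \<xi> *\<^sub>R u) *\<^sub>R u - h t *\<^sub>R u) \<partial>uniform_sphere)"
      by (simp add: est_def algebra_simps)
    also have "\<dots> = (real DIM('a) / \<xi>) *\<^sub>R (\<integral>u. h (t + \<xi> *\<^sub>R u) *\<^sub>R u - h t *\<^sub>R u \<partial>uniform_sphere)"
      by (rule integral_scaleR_right)
    also have "(\<integral>u. h (t + \<xi> *\<^sub>R u) *\<^sub>R u - h t *\<^sub>R u \<partial>uniform_sphere)
        = (\<integral>u. h (t + \<xi> *\<^sub>R u) *\<^sub>R u \<partial>uniform_sphere) - h t *\<^sub>R (\<integral>u. u \<partial>uniform_sphere)"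
      using ih[of t] iu[of "h t"] by simp
    finally show ?thesis by (simp add: G_def integral_uniform_sphere_id)
  qed
  then show "(\<integral>u. est \<theta> u \<partial>uniform_sphere) = G \<theta>" .
  show "norm (G \<theta>) \<le> real DIM('a) * L" unfolding eq[symmetric] by (rule int)
  have "G \<theta> - G \<theta>' = (real DIM('a) / \<xi>) *\<^sub>R
      (\<integral>u. h (\<theta> + \<xi> *\<^sub>R u) *\<^sub>R u - h (\<theta>' + \<xi> *\<^sub>R u) *\<^sub>R u \<partial>uniform_sphere)"
    using ih by (simp add: G_def scaleR_diff_right)
  moreover have "norm (\<integral>u. h (\<theta> + \<xi> *\<^sub>R u) *\<^sub>R u - h (\<theta>' + \<xi> *\<^sub>R u) *\<^sub>R u \<partial>uniform_sphere) \<le> L * norm (\<theta> - \<theta>')"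
  proof (rule integrable_uniform_sphere)
    fix v :: 'a assume v: "norm v = 1"
    show "norm (h (\<theta> + \<xi> *\<^sub>R v) *\<^sub>R v - h (\<theta>' + \<xi> *\<^sub>R v) *\<^sub>R v) \<le> L * norm (\<theta> - \<theta>')"
      using lip[of "\<theta> + \<xi> *\<^sub>R v" "\<theta>' + \<xi> *\<^sub>R v"] v by (simp flip: scaleR_diff_left)
  qed measurable
  ultimately show "norm (G \<theta> - G \<theta>') \<le> real DIM('a) * L / \<xi> * norm (\<theta> - \<theta>')"
    using \<xi> mult_left_mono[of _ _ "real DIM('a) / \<xi>"] by (fastforce simp: mult.assoc)
qed

section \<open>Application to the penalized objective of the game\<close>

theorem corollary3:
  fixes own :: "'d::finite \<Rightarrow> 'p::finite"
    and X :: "'p \<Rightarrow> (real ^ 'd) set"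
    and f :: "'p \<Rightarrow> real ^ 'd \<Rightarrow> real ^ 'n::finite \<Rightarrow> real"
    and \<Theta> :: "(real ^ 'n) set"
    and E :: "('p \<times> 'p) set" and A :: "real ^ 'p ^ 'p"
    and L\<^sub>F \<xi> \<alpha>\<^sub>0 :: real
    and \<theta>\<^sub>0 :: "real ^ 'n"
    and M :: "nat \<Rightarrow> 'w measure"
    and u :: "nat \<Rightarrow> nat \<Rightarrow> 'w \<Rightarrow> real ^ 'n"
  assumes "regular_game own X f \<Theta>"
    and "regular_pseudo_gradient own X f"
    and "communication_graph E A"
    and "L\<^sub>F > 0"
    and "\<And>i t t'. \<bar>objective own X f i t - objective own X f i t'\<bar> \<le> L\<^sub>F * norm (t - t')"
    and "\<xi> > 0"
    and "\<exists>t. \<forall>t'. penalized_objective own X f \<Theta> \<xi> t \<le> penalized_objective own X f \<Theta> \<xi> t'"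
    and "\<alpha>\<^sub>0 > 0"
    and "\<theta>\<^sub>0 \<in> \<Theta>"
    and "\<And>K. K \<ge> 1 \<Longrightarrow> prob_space (M K)"
    and "\<And>K. K \<ge> 1 \<Longrightarrow> prob_space.indep_vars (M K) (\<lambda>_. borel) (u K) {..<K}"
    and "\<And>K k. K \<ge> 1 \<Longrightarrow> k < K \<Longrightarrow> distr (M K) borel (u K k) = uniform_sphere"
  shows "\<exists>C>0. \<forall>K\<ge>1.
     let \<alpha> = \<alpha>\<^sub>0 / sqrt (real K);
         \<theta> = (\<lambda>k \<omega>. zo_iterate own X f \<Theta> \<xi> \<alpha> \<theta>\<^sub>0 (\<lambda>j. u K j \<omega>) k);
         sq_grad = (\<lambda>k \<omega>. (norm (gradient (penalized_objective own X f \<Theta> \<xi>) (\<theta> k \<omega>)))\<^sup>2)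
     in \<alpha> \<le> \<xi> / (2 * (real CARD('n) * real CARD('p) * L\<^sub>F + 1)) \<longrightarrow>
        (\<forall>k<K. integrable (M K) (sq_grad k)) \<and>
        1 / real K * (\<Sum>k<K. \<integral>\<omega>. sq_grad k \<omega> \<partial>M K) \<le> C / sqrt (real K)"
proof -
  have \<Theta>: "closed \<Theta>" "convex \<Theta>" "\<Theta> \<noteq> {}"
    using assms(1) by (auto simp: regular_game_def)
  note \<xi> = \<open>\<xi> > 0\<close>
  define F where "F = objective own X f"
  define h where "h \<theta> = (\<Sum>i\<in>UNIV. F i \<theta>)" for \<theta>
  define L where "L = real CARD('p) * L\<^sub>F"
  define n where "n = real CARD('n)"
  have L: "0 < L" and n: "0 < n" using \<open>L\<^sub>F > 0\<close> by (simp_all add: L_def n_def)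
  have F_lip: "\<bar>F i x - F i y\<bar> \<le> L\<^sub>F * norm (x - y)" for i x y unfolding F_def by (rule assms(5))
  have F_cont: "continuous_on UNIV (F i)" for i
    using F_lip by (intro lipschitz_imp_continuous_UNIV[where L = L\<^sub>F]) auto
  have h_lip: "\<bar>h x - h y\<bar> \<le> L * norm (x - y)" for x y
  proof -
    have "\<bar>h x - h y\<bar> \<le> (\<Sum>i\<in>UNIV. \<bar>F i x - F i y\<bar>)"
      unfolding h_def sum_subtractf[symmetric] by (rule sum_abs)
    also have "\<dots> \<le> (\<Sum>i\<in>(UNIV :: 'p set). L\<^sub>F * norm (x - y))"
      by (intro sum_mono F_lip)
    finally show ?thesis by (simp add: L_def)
  qed
  have h_cont: "continuous_on UNIV h"
    using h_lip by (intro lipschitz_imp_continuous_UNIV[where L = L]) auto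
  define S where "S = smoothed_objective own X f \<xi>"
  define P where "P = penalized_objective own X f \<Theta> \<xi>"
  define GS where "GS \<theta> = (n / \<xi>) *\<^sub>R (\<integral>u. h (\<theta> + \<xi> *\<^sub>R u) *\<^sub>R u \<partial>uniform_sphere)" for \<theta>
  define pen where "pen \<theta> = (1 / \<xi>) *\<^sub>R (\<theta> - closest_point \<Theta> \<theta>)" for \<theta>
  define G where "G \<theta> = GS \<theta> + pen \<theta>" for \<theta>
  define est where "est \<theta> u = (n / \<xi> * (h (\<theta> + \<xi> *\<^sub>R u) - h \<theta>)) *\<^sub>R u" for \<theta> u
  define g where "g \<theta> u = est \<theta> u + pen \<theta>" for \<theta> u
  \<comment> \<open>The estimate and its mean are each bounded by \<open>n * L\<close>; the penalty
    gradient is deterministic and cancels in the noise.\<close>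
  define \<sigma> where "\<sigma> = 2 * (n * L)"
  \<comment> \<open>The smoothness constant adds \<open>n * L / \<xi>\<close> from the smoothed
    objective and \<open>1 / \<xi>\<close> from the penalty. The assumed bound on \<alpha> says
    exactly that \<open>M' * \<alpha> \<le> 1 / 2\<close>.\<close>
  define M' where "M' = (n * L + 1) / \<xi>"
  have est_props: "integrable uniform_sphere (est \<theta>)" "(\<integral>u. est \<theta> u \<partial>uniform_sphere) = GS \<theta>"
      "norm u = 1 \<Longrightarrow> norm (est \<theta> u) \<le> n * L" "norm (GS \<theta>) \<le> n * L"
      "norm (GS \<theta> - GS \<theta>') \<le> n * L / \<xi> * norm (\<theta> - \<theta>')" for \<theta> \<theta>' u
    using two_point_estimate[OF h_lip \<xi>] by (simp_all add: GS_def[abs_def] est_def[abs_def] n_def)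
  have estimate: "gradient_estimate own X f \<xi> \<theta> w = est \<theta> w" for \<theta> w
    unfolding gradient_estimate_def est_def h_def F_def objective_def n_def
      scaleR_sum_left[symmetric] sum_distrib_left[symmetric] sum_subtractf ..
  \<comment> \<open>Integrability of each player's objective over the ball permits exchanging sum
    and integral, so the scalar theory applies to the single function \<open>h\<close>.\<close>
  have S_eq: "S \<theta> = (\<integral>\<nu>. h (\<theta> + \<xi> *\<^sub>R \<nu>) \<partial>uniform_ball)" for \<theta>
  proof -
    have "integrable uniform_ball (\<lambda>\<nu>. F i (\<theta> + \<xi> *\<^sub>R \<nu>))" for i
    proof (rule integrable_uniform_ball)
      show "(\<lambda>\<nu>. F i (\<theta> + \<xi> *\<^sub>R \<nu>)) \<in> borel_measurable borel"
        by (intro borel_measurable_continuous_onI continuous_on_compose2[OF F_cont] continuous_intros) auto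
      fix \<nu> :: "real ^ 'n" assume "norm \<nu> \<le> 1"
      then have "L\<^sub>F * norm (\<xi> *\<^sub>R \<nu>) \<le> L\<^sub>F * \<xi>"
        using \<xi> \<open>L\<^sub>F > 0\<close> by (intro mult_left_mono) auto
      then show "norm (F i (\<theta> + \<xi> *\<^sub>R \<nu>)) \<le> \<bar>F i \<theta>\<bar> + L\<^sub>F * \<xi>"
        using F_lip[of i "\<theta> + \<xi> *\<^sub>R \<nu>" \<theta>] by simp
    qed
    then show ?thesis
      unfolding S_def smoothed_objective_def h_def F_def[symmetric] by simp
  qed
  have S_deriv: "GDERIV S \<theta> :> GS \<theta>" for \<theta>
    using GDERIV_ball_average[OF h_lip \<xi>, of \<theta>] by (simp add: S_eq[abs_def] GS_def n_def)
  have P_eq: "P \<theta> = S \<theta> + 1 / (2 * \<xi>) * (infdist \<theta> \<Theta>)\<^sup>2" for \<theta>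
    by (simp add: P_def S_def penalized_objective_def)
  have P_deriv: "GDERIV P \<theta> :> G \<theta>" for \<theta>
    using GDERIV_add[OF S_deriv GDERIV_mult[OF GDERIV_const[of "1 / (2 * \<xi>)"] GDERIV_infdist_sq[OF \<Theta>]], of \<theta>]
    by (simp add: P_eq[abs_def] G_def pen_def)
  have P_cont: "continuous_on UNIV P"
    using P_deriv by (auto simp: gderiv_def continuous_on_eq_continuous_within
        intro!: has_derivative_continuous[THEN continuous_at_imp_continuous_at_within])
  have smooth: "P y \<le> P x + G x \<bullet> (y - x) + M' / 2 * (norm (y - x))\<^sup>2" for x y
  proof -
    have "1 / (2 * \<xi>) * (infdist y \<Theta>)\<^sup>2 \<le> 1 / (2 * \<xi>) *
        ((infdist x \<Theta>)\<^sup>2 + 2 * ((x - closest_point \<Theta> x) \<bullet> (y - x)) + (norm (y - x))\<^sup>2)"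
      using \<xi> by (intro mult_left_mono infdist_sq_upper \<Theta>) auto
    also have "\<dots> = 1 / (2 * \<xi>) * (infdist x \<Theta>)\<^sup>2 + pen x \<bullet> (y - x) + (1 / \<xi>) / 2 * (norm (y - x))\<^sup>2"
      unfolding pen_def inner_scaleR_left using \<xi> by (simp add: field_simps)
    finally have "1 / (2 * \<xi>) * (infdist y \<Theta>)\<^sup>2 \<le> \<dots>" .
    moreover have "S y \<le> S x + GS x \<bullet> (y - x) + (n * L / \<xi>) / 2 * (norm (y - x))\<^sup>2"
      by (rule descent_lemma[OF S_deriv est_props(5)])
    ultimately show ?thesis
      by (simp add: P_eq G_def M'_def inner_add_left add_divide_distrib algebra_simps)
  qed
  have pen_cont: "continuous_on UNIV pen"
    unfolding pen_def by (intro continuous_intros continuous_on_closest_point \<Theta>)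
  have G_cont: "continuous_on UNIV G"
    unfolding G_def using est_props(5)
    by (intro continuous_on_add pen_cont lipschitz_imp_continuous_UNIV[where L = "n * L / \<xi>"])
  have g_meas: "(\<lambda>z. g (fst z) (snd z)) \<in> borel_measurable borel"
    unfolding g_def est_def
    by (intro borel_measurable_continuous_onI continuous_intros continuous_on_compose2[OF h_cont]
        continuous_on_compose2[OF pen_cont]) auto
  interpret sphere: prob_space "uniform_sphere :: (real ^ 'n) measure" by (rule prob_space_uniform_sphere)
  have unbiased: "integrable uniform_sphere (g \<theta>)" "(\<integral>u. g \<theta> u \<partial>uniform_sphere) = G \<theta>" for \<theta>
    using est_props(1,2)[of \<theta>] by (simp_all add: g_def[abs_def] G_def sphere.prob_space)
  have noise: "AE u in uniform_sphere. \<forall>\<theta>. norm (g \<theta> u - G \<theta>) \<le> \<sigma>"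
    using AE_uniform_sphere
  proof eventually_elim
    case (elim u)
    have "norm (est \<theta> u - GS \<theta>) \<le> n * L + n * L" for \<theta>
      using est_props(3)[OF elim] est_props(4) by (intro order_trans[OF norm_triangle_ineq4] add_mono)
    then show ?case by (simp add: g_def G_def \<sigma>_def mult.commute)
  qed
  obtain t where t: "\<And>t'. P t \<le> P t'" using assms(7) unfolding P_def by blast
  \<comment> \<open>This is the descent bound divided by \<open>K\<close> at
    \<open>\<alpha> = \<alpha>\<^sub>0 / sqrt K\<close>, with \<open>1 / sqrt K\<close> factored
    out. The noise term keeps it positive even if \<open>\<theta>\<^sub>0\<close> is a
    minimizer.\<close>
  define C where "C = 2 * (P \<theta>\<^sub>0 - P t) / \<alpha>\<^sub>0 + 2 * M' * \<sigma>\<^sup>2 * \<alpha>\<^sub>0"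
  have M': "M' > 0" and \<sigma>: "\<sigma> > 0" using L n \<xi> by (simp_all add: M'_def \<sigma>_def add_pos_pos)
  have "C > 0"
    unfolding C_def using M' \<sigma> \<open>\<alpha>\<^sub>0 > 0\<close> t[of \<theta>\<^sub>0] by (intro add_nonneg_pos) auto
  have main: "(\<forall>k<K. integrable (M K) (\<lambda>\<omega>. (norm (G (zo_iterate own X f \<Theta> \<xi> \<alpha> \<theta>\<^sub>0 (\<lambda>j. u K j \<omega>) k)))\<^sup>2)) \<and>
      1 / real K * (\<Sum>k<K. \<integral>\<omega>. (norm (G (zo_iterate own X f \<Theta> \<xi> \<alpha> \<theta>\<^sub>0 (\<lambda>j. u K j \<omega>) k)))\<^sup>2 \<partial>M K) \<le> C / sqrt (real K)"
    if K: "K \<ge> 1" and \<alpha>_def: "\<alpha> = \<alpha>\<^sub>0 / sqrt (real K)"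
      and \<alpha>_le: "\<alpha> \<le> \<xi> / (2 * (real CARD('n) * real CARD('p) * L\<^sub>F + 1))" for K \<alpha>
  proof -
    interpret prob_space "M K" by (rule assms(10)[OF K])
    have \<alpha>: "\<alpha> > 0" using K \<open>\<alpha>\<^sub>0 > 0\<close> by (simp add: \<alpha>_def)
    have nL: "n * L + 1 > 0" using n L by (simp add: add_pos_pos)
    have "\<alpha> \<le> \<xi> / (2 * (n * L + 1))" using \<alpha>_le by (simp add: n_def L_def mult.assoc)
    then have M'\<alpha>: "M' * \<alpha> \<le> 1 / 2" using nL \<xi> by (simp add: M'_def field_simps)
    have step: "zo_iterate own X f \<Theta> \<xi> \<alpha> \<theta>\<^sub>0 v (Suc k) =
        zo_iterate own X f \<Theta> \<xi> \<alpha> \<theta>\<^sub>0 v k - \<alpha> *\<^sub>R g (zo_iterate own X f \<Theta> \<xi> \<alpha> \<theta>\<^sub>0 v k) (v k)" for v k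
      by (simp add: Let_def g_def estimate pen_def)
    note sgd = stochastic_gradient_descent[of "zo_iterate own X f \<Theta> \<xi> \<alpha> \<theta>\<^sub>0", OF _ step
        assms(11)[OF K] assms(12)[OF K] P_cont t G_cont smooth g_meas unbiased noise \<alpha> less_imp_le[OF M'] M'\<alpha>]
    define s where "s = sqrt (real K)"
    have s: "real K = s * s" "s > 0" using K by (auto simp: s_def)
    have "1 / real K * (\<Sum>k<K. \<integral>\<omega>. (norm (G (zo_iterate own X f \<Theta> \<xi> \<alpha> \<theta>\<^sub>0 (\<lambda>j. u K j \<omega>) k)))\<^sup>2 \<partial>M K)
        \<le> 1 / real K * (2 * (P \<theta>\<^sub>0 - P t) / \<alpha> + 2 * M' * \<sigma>\<^sup>2 * \<alpha> * real K)"
      by (intro mult_left_mono sgd) auto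
    also have "\<dots> = C / sqrt (real K)"
      unfolding C_def \<alpha>_def s_def[symmetric] s(1)
      using s(2) \<open>\<alpha>\<^sub>0 > 0\<close> by (simp add: field_simps)
    finally show ?thesis using sgd(1) by auto
  qed
  show ?thesis
    unfolding Let_def P_def[symmetric] gradient_eqI[OF P_deriv]
    using \<open>C > 0\<close> main by blast
qed

end
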